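(* Let $\alpha>-\frac12$, $c\geq 1$, and let $(\lambda_n^{\alpha}(c))_{n\ge0}$ be the sequence of eigenvalues of the integral operator $\mathcal Q_c^{\alpha}$. For every $0<\epsilon<\frac12$, $$\#\{n\,;\ \epsilon<\lambda_n^{\alpha}(c)<1-\epsilon\}\leq \frac{16\left[\frac{\ln(\frac c\pi)}{2\pi^2}+\frac{3}{4\pi^3}+\frac{\ln(\frac83)}{\pi^2}+\frac{2c}{\pi}+1.123\right]+2C^2+4\kappa_1\ln(2)+\frac{\kappa_2}{c^2}}{\epsilon(1-\epsilon)},$$ where $$\kappa_1=\frac{4}{\pi^2}\left(1+\Big(1+\sqrt{\tfrac\pi2}\,C_\alpha(O)\Big)^2\right),\qquad \kappa_2=\frac{8\,C_{\alpha+1}(K)^2}{\pi^2}\left(1+\Big(1+\sqrt{\tfrac\pi2}\,C_\alpha(O)\Big)^2\right),$$ and $$C=\sqrt{\tfrac2\pi}\left[2C_{\alpha+1}(O)\Big(1+\sqrt{\tfrac\pi2}\,C_\alpha(O)\Big)+C_\alpha(K)\,\frac{(3\alpha+\frac72)C_{\alpha+2}(O)+(\alpha+\frac32)C_\alpha(O)}{2(\alpha+1)}\right]$$ $$\qquad+\sqrt{\tfrac2\pi}\left[\sqrt{\tfrac\pi2}\,C_{\alpha+1}(O)\Big(\big(\tfrac32+\alpha\big)C_\alpha(O)+C_{\alpha+1}(K)\Big)+C_{\alpha+1}(K)+\big(\tfrac52+\alpha\big)C_{\alpha+1}(O)+C_{\alpha+2}(K)\right].$$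
   Context: $J_\alpha$ denotes the Bessel function of the first kind of order $\alpha$. For $c>0$, the finite Hankel transform operator $\mathcal H_c^{\alpha}$ is the integral operator on $L^2(0,1)$ given by $\mathcal H_c^{\alpha}f(x)=\int_0^1\sqrt{cxy}\,J_\alpha(cxy)f(y)\,dy$. The operator $\mathcal Q_c^{\alpha}=c\,\mathcal H_c^{\alpha}\mathcal H_c^{\alpha}$ is a positive, self-adjoint, compact integral operator on $L^2(0,1)$; its infinite, countable sequence of eigenvalues (counted with multiplicity) is $(\lambda_n^{\alpha}(c))_{n\geq 0}$. Constants: for real $\nu>-\frac12$, $C_\nu(O)=\sqrt{2/\pi}$ if $|\nu|\leq\frac12$ and $C_\nu(O)=0.675\sqrt{\nu^{1/3}+\frac{1.9}{\nu^{1/3}}+\frac{1.1}{\nu}}$ if $\nu>\frac12$; and $C_\nu(K)=\frac45\left|\nu^2-\frac14\right|$. *)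

theory Defs
  imports "HOL-Analysis.Analysis"
begin

text \<open>The Bessel function of the first kind of real order \<open>\<alpha>\<close>, for arguments \<open>x > 0\<close>. Since
  \<open>rGamma\<close> is the reciprocal Gamma function, the poles of Gamma need no special treatment. At
  \<open>x = 0\<close> the value is \<open>0\<close> (also for \<open>\<alpha> = 0\<close>), because \<open>0 powr a = 0\<close>.\<close>

definition bessel_J :: "real \<Rightarrow> real \<Rightarrow> real" where
  "bessel_J \<alpha> x =
     (\<Sum>m. (-1) ^ m * rGamma (of_nat m + \<alpha> + 1) / fact m * (x / 2) powr (2 * of_nat m + \<alpha>))"

definition unit_measure :: "real measure" where
  "unit_measure = restrict_space lborel {0<..<1}"

text \<open>Elements of \<open>L\<^sup>2(0,1)\<close> are represented by functions; functions that agree almost everywhere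
  are identified explicitly wherever this matters.\<close>

definition L2_unit :: "(real \<Rightarrow> real) set" where
  "L2_unit = {f \<in> borel_measurable unit_measure. integrable unit_measure (\<lambda>x. (f x)\<^sup>2)}"

definition hankel_op :: "real \<Rightarrow> real \<Rightarrow> (real \<Rightarrow> real) \<Rightarrow> real \<Rightarrow> real" where
  "hankel_op \<alpha> c f x = (\<integral>y. sqrt (c * x * y) * bessel_J \<alpha> (c * x * y) * f y \<partial>unit_measure)"

definition Q_op :: "real \<Rightarrow> real \<Rightarrow> (real \<Rightarrow> real) \<Rightarrow> real \<Rightarrow> real" where
  "Q_op \<alpha> c f x = c * hankel_op \<alpha> c (hankel_op \<alpha> c f) x"

definition Q_eigenspace :: "real \<Rightarrow> real \<Rightarrow> real \<Rightarrow> (real \<Rightarrow> real) set" where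
  "Q_eigenspace \<alpha> c \<mu> =
     {f \<in> L2_unit. AE x in unit_measure. Q_op \<alpha> c f x = \<mu> * f x}"

text \<open>The space of functions \<open>V\<close>, taken modulo equality almost everywhere, has finite dimension
  \<open>k\<close>: it has a basis \<open>b 0, \<dots>, b (k - 1)\<close>, i.e. every element has a unique coordinate vector.\<close>

definition has_dim_ae :: "'a measure \<Rightarrow> ('a \<Rightarrow> real) set \<Rightarrow> nat \<Rightarrow> bool" where
  "has_dim_ae M V k \<longleftrightarrow>
     (\<exists>b :: nat \<Rightarrow> 'a \<Rightarrow> real. (\<forall>i<k. b i \<in> V) \<and>
        (\<forall>f\<in>V. \<exists>!a. a \<in> extensional {..<k} \<and> (AE x in M. f x = (\<Sum>i<k. a i * b i x))))"

text \<open>The sequence \<open>lam\<close> enumerates the eigenvalues of the operator, each repeated according to its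
  multiplicity (the dimension of its eigenspace), in no particular order. The operator is compact
  and injective, so every eigenspace, including the one for \<open>\<mu> = 0\<close>, has finite dimension. Numbers
  that are not eigenvalues have a zero-dimensional eigenspace, hence do not occur in \<open>lam\<close>.\<close>

definition Q_eigenvalue_seq :: "real \<Rightarrow> real \<Rightarrow> (nat \<Rightarrow> real) \<Rightarrow> bool" where
  "Q_eigenvalue_seq \<alpha> c lam \<longleftrightarrow>
     (\<forall>\<mu>. finite {n. lam n = \<mu>} \<and>
           has_dim_ae unit_measure (Q_eigenspace \<alpha> c \<mu>) (card {n. lam n = \<mu>}))"

definition C_O :: "real \<Rightarrow> real" where
  "C_O \<nu> = (if \<bar>\<nu>\<bar> \<le> 1/2 then sqrt (2 / pi)
            else 0.675 * sqrt (\<nu> powr (1/3) + 1.9 / \<nu> powr (1/3) + 1.1 / \<nu>))"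

definition C_K :: "real \<Rightarrow> real" where
  "C_K \<nu> = 4 / 5 * \<bar>\<nu>\<^sup>2 - 1 / 4\<bar>"

definition kappa1 :: "real \<Rightarrow> real" where
  "kappa1 \<alpha> = 4 / pi\<^sup>2 * (1 + (1 + sqrt (pi / 2) * C_O \<alpha>)\<^sup>2)"

definition kappa2 :: "real \<Rightarrow> real" where
  "kappa2 \<alpha> = 8 * (C_K (\<alpha> + 1))\<^sup>2 / pi\<^sup>2 * (1 + (1 + sqrt (pi / 2) * C_O \<alpha>)\<^sup>2)"

definition C_const :: "real \<Rightarrow> real" where
  "C_const \<alpha> =
     sqrt (2 / pi) *
       (2 * C_O (\<alpha> + 1) * (1 + sqrt (pi / 2) * C_O \<alpha>)
        + C_K \<alpha> * (((3 * \<alpha> + 7/2) * C_O (\<alpha> + 2) + (\<alpha> + 3/2) * C_O \<alpha>) / (2 * (\<alpha> + 1))))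
   + sqrt (2 / pi) *
       (sqrt (pi / 2) * C_O (\<alpha> + 1) * ((3/2 + \<alpha>) * C_O \<alpha> + C_K (\<alpha> + 1))
        + C_K (\<alpha> + 1) + (5/2 + \<alpha>) * C_O (\<alpha> + 1) + C_K (\<alpha> + 2))"

end

(* The count is at most trace / \<epsilon>, and the term 32 c / \<pi> of the bound is far larger than the trace
   c \<integral>\<integral> (cxy) J(cxy)^2 dx dy, so no finer spectral information is needed. Orthonormal eigenfunctions
   e of Q = c H H satisfy \<lambda> = c |H e|^2; summing these with Bessel's inequality for the sections of
   the kernel bounds the sum of any finitely many eigenvalues by the trace.

   For the trace, the substitution s = y^2 and the weight exp(1 - s) >= 1 on (0,1) reduce each
   section to the Weber integral of exp(-s) J(a sqrt s)^2 over (0,\<infinity>). Integrating the power series of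
   J^2 termwise (Vandermonde, Legendre duplication, Beta integral) gives, with b = \<alpha> + 1/2,
     a^(2 \<alpha>) / (sqrt \<pi> \<Gamma>(b)) * \<integral>_0^1 exp(-a^2 v) (v (1 - v))^(b - 1) dv,
   whose integrand is positive, so that the oscillation of J no longer matters: this is at most
   4 / (a sqrt \<pi>). *)

theory Submission
  imports Defs
begin

subsection \<open>Gamma and Beta integrals\<close>

text \<open>For a nonnegative integrand the gauge integral is the Lebesgue integral, computed here
  as an \<open>nn_integral\<close>. This carries the known gauge integrals for Gamma and Beta over
  to restricted measures, where series can be integrated termwise.\<close>

lemma has_bochner_integral_restrict_lborel:
  fixes f :: "real \<Rightarrow> real"
  assumes S: "S \<in> sets borel" and f: "f \<in> borel_measurable borel"
    and nonneg: "\<And>x. x \<in> S \<Longrightarrow> 0 \<le> f x" and I: "(f has_integral I) S"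
  shows "has_bochner_integral (restrict_space lborel S) f I"
proof (rule has_bochner_integral_nn_integral)
  show "f \<in> borel_measurable (restrict_space lborel S)"
    using f by (intro measurable_restrict_space1) simp
  show "AE x in restrict_space lborel S. 0 \<le> f x"
    using nonneg by (intro AE_I2) (simp add: space_restrict_space)
  show "0 \<le> I" using has_integral_nonneg[OF I] nonneg by blast
  have "(\<integral>\<^sup>+x. ennreal (f x) \<partial>restrict_space lborel S) = (\<integral>\<^sup>+x. ennreal (f x) * indicator S x \<partial>lborel)"
    using S by (intro nn_integral_restrict_space) simp
  also have "\<dots> = (\<integral>\<^sup>+x. ennreal (indicator S x * f x) \<partial>lborel)"
    by (intro nn_integral_cong) (simp add: indicator_def)
  also have "\<dots> = (\<integral>\<^sup>+x. ennreal (indicator S x * f x) \<partial>lebesgue)"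
    using S f by (subst nn_integral_completion) auto
  also have "\<dots> = ennreal I"
    using nn_integral_has_integral_lebesgue[OF nonneg I] S f by (simp add: nn_integral_completion)
  finally show "(\<integral>\<^sup>+x. ennreal (f x) \<partial>restrict_space lborel S) = ennreal I" .
qed

lemma space_unit_measure: "space unit_measure = {0<..<1}"
  by (simp add: unit_measure_def space_restrict_space)

lemma measurable_unit_measure: "f \<in> borel_measurable borel \<Longrightarrow> f \<in> borel_measurable unit_measure"
  unfolding unit_measure_def by (intro measurable_restrict_space1) simp

lemma Gamma_has_bochner_integral:
  fixes x :: real
  assumes "x > 0"
  shows "has_bochner_integral (restrict_space lborel {0<..}) (\<lambda>t. t powr (x - 1) * exp (- t)) (Gamma x)"
proof (rule has_bochner_integral_restrict_lborel)
  have "((\<lambda>t. t powr (x - 1) / exp t) has_integral Gamma x) {0..}"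
    by (rule Gamma_integral_real[OF assms])
  then have "((\<lambda>t. if t \<in> {0<..} then t powr (x - 1) / exp t else 0) has_integral Gamma x) {0..}"
    by (rule has_integral_spike [of "{0}", rotated 2]) auto
  then have "((\<lambda>t. t powr (x - 1) / exp t) has_integral Gamma x) {0<..}"
    by (subst (asm) has_integral_restrict) auto
  then show "((\<lambda>t. t powr (x - 1) * exp (- t)) has_integral Gamma x) {0<..}"
    by (simp add: exp_minus divide_inverse)
qed auto

lemma Beta_has_bochner_integral:
  fixes a b :: real
  assumes "a > 0" "b > 0"
  shows "has_bochner_integral unit_measure (\<lambda>t. t powr (a - 1) * (1 - t) powr (b - 1)) (Beta a b)"
  unfolding unit_measure_def
proof (rule has_bochner_integral_restrict_lborel)
  show "((\<lambda>t. t powr (a - 1) * (1 - t) powr (b - 1)) has_integral Beta a b) {0<..<1}"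
    using has_integral_Beta_real[OF assms] by (simp add: has_integral_Icc_iff_Ioo)
qed auto

text \<open>The complex Legendre formula is read on the positive real axis, where no argument is a
  pole and every factor is real.\<close>

lemma Gamma_duplication_real:
  fixes z :: real
  assumes "z > 0"
  shows "Gamma z * Gamma (z + 1/2) = 2 powr (1 - 2*z) * sqrt pi * Gamma (2*z)"
proof -
  have n: "complex_of_real w \<notin> \<int>\<^sub>\<le>\<^sub>0" if "w > 0" for w
    using that nonpos_Ints_nonpos[of w] by (auto simp: of_real_in_nonpos_Ints_iff)
  have "Gamma (of_real z) * Gamma (of_real z + 1/2) =
      exp ((1 - 2 * of_real z) * of_real (ln 2)) * of_real (sqrt pi) * Gamma (2*complex_of_real z)"
    using n[of z] n[of "z+1/2"] assms by (intro Gamma_legendre_duplication) auto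
  also have "Gamma (of_real z) * Gamma (of_real z + 1/2) = complex_of_real (Gamma z * Gamma (z + 1/2))"
    using Gamma_complex_of_real[of "z+1/2"] by (simp add: Gamma_complex_of_real)
  also have "exp ((1 - 2 * of_real z) * of_real (ln 2)) * of_real (sqrt pi) * Gamma (2*complex_of_real z)
     = complex_of_real (exp ((1 - 2*z) * ln 2) * sqrt pi * Gamma (2*z))"
    using Gamma_complex_of_real[of "2*z"] by (simp flip: exp_of_real)
  finally show ?thesis unfolding of_real_eq_iff by (simp add: powr_def)
qed

subsection \<open>The square of the Bessel function\<close>

lemma rGamma_pos: "x > 0 \<Longrightarrow> rGamma x > (0::real)"
  by (simp add: rGamma_inverse_Gamma Gamma_real_pos)

text \<open>In the recurrence \<open>z * rGamma (z + 1) = rGamma z\<close> the factor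
  \<open>z\<close> exceeds 1/2, so each step at most doubles the value. This crude growth is
  harmless against the factorial in the Bessel series.\<close>

lemma rGamma_Suc_le:
  fixes \<alpha> :: real
  assumes "\<alpha> > -1/2"
  shows "rGamma (of_nat m + \<alpha> + 1) \<le> rGamma (\<alpha> + 1) * 2 ^ m"
proof (induction m)
  case (Suc m)
  let ?z = "of_nat m + \<alpha> + 1"
  have z: "?z > 1/2" using assms by simp
  have "?z * rGamma (?z + 1) = rGamma ?z" by (rule rGamma_plus1)
  moreover have "1/2 * rGamma (?z + 1) \<le> ?z * rGamma (?z + 1)"
    using z rGamma_pos[of "?z + 1"] by (intro mult_right_mono) auto
  ultimately have "rGamma (?z + 1) \<le> 2 * rGamma ?z" by simp
  with Suc show ?case by (simp add: add_ac)
qed simp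

lemma summable_bessel_coeffs:
  fixes \<alpha> t :: real
  assumes "\<alpha> > -1/2" and "t \<ge> 0"
  shows "summable (\<lambda>m. rGamma (of_nat m + \<alpha> + 1) / fact m * t ^ m)"
proof (rule summable_comparison_test')
  show "summable (\<lambda>m. rGamma (\<alpha> + 1) * ((2 * t) ^ m / fact m))"
    using summable_exp_generic[of "2 * t"] by (intro summable_mult) (simp add: scaleR_conv_of_real field_simps)
  fix m :: nat
  have "rGamma (of_nat m + \<alpha> + 1) > 0" using assms by (intro rGamma_pos) simp
  then show "norm (rGamma (of_nat m + \<alpha> + 1) / fact m * t ^ m) \<le> rGamma (\<alpha> + 1) * ((2 * t) ^ m / fact m)"
    using mult_right_mono[OF rGamma_Suc_le[OF assms(1), of m], of "t ^ m / fact m"] assms(2)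
    by (simp add: power_mult_distrib mult_ac)
qed

lemma norm_bessel_term:
  fixes \<alpha> x :: real
  assumes "\<alpha> > -1/2" and "x > 0"
  shows "norm ((-1) ^ m * rGamma (of_nat m + \<alpha> + 1) / fact m * (x / 2) powr (2 * of_nat m + \<alpha>)) =
     (x / 2) powr \<alpha> * (rGamma (of_nat m + \<alpha> + 1) / fact m * ((x / 2)\<^sup>2) ^ m)"
proof -
  have "rGamma (of_nat m + \<alpha> + 1) > 0" using assms by (intro rGamma_pos) simp
  moreover have "(x / 2) powr (2 * of_nat m + \<alpha>) = ((x / 2)\<^sup>2) ^ m * (x / 2) powr \<alpha>"
    using assms(2) powr_realpow[of "x/2" "2*m"] by (simp add: powr_add power_mult)
  ultimately show ?thesis using assms(2) by (simp add: abs_mult mult_ac)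
qed

lemma summable_norm_bessel:
  fixes \<alpha> x :: real
  assumes "\<alpha> > -1/2" and "x > 0"
  shows "summable (\<lambda>m. norm ((-1) ^ m * rGamma (of_nat m + \<alpha> + 1) / fact m * (x / 2) powr (2 * of_nat m + \<alpha>)))"
  unfolding norm_bessel_term[OF assms]
  by (intro summable_mult summable_bessel_coeffs assms) simp

lemma measurable_bessel_J [measurable]: "bessel_J \<alpha> \<in> borel_measurable borel"
  unfolding bessel_J_def by measurable

text \<open>Near 0 the function J behaves like t^\<alpha>, unbounded for negative \<alpha>; the
  factor sqrt t lifts the exponent to \<alpha> + 1/2 > 0. The remaining series of absolute values is
  increasing in t, so both factors are largest at t = c.\<close>

lemma bessel_kernel_bounded:
  assumes "\<alpha> > -1/2" and "c > 0"
  obtains B where "\<And>t. 0 < t \<Longrightarrow> t \<le> c \<Longrightarrow> \<bar>sqrt t * bessel_J \<alpha> t\<bar> \<le> B"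
proof
  fix t :: real assume t: "0 < t" "t \<le> c"
  let ?r = "\<lambda>m. rGamma (of_nat m + \<alpha> + 1) / fact m"
  have r: "?r m > 0" for m using assms rGamma_pos[of "of_nat m + \<alpha> + 1"] by simp
  note sn = summable_norm_bessel[OF assms(1) t(1)]
  have "\<bar>bessel_J \<alpha> t\<bar> \<le> (\<Sum>m. (t / 2) powr \<alpha> * (?r m * ((t / 2)\<^sup>2) ^ m))"
    using summable_norm[OF sn] unfolding norm_bessel_term[OF assms(1) t(1)]
    by (simp add: bessel_J_def)
  also have "\<dots> = (t / 2) powr \<alpha> * (\<Sum>m. ?r m * ((t / 2)\<^sup>2) ^ m)"
    by (intro suminf_mult summable_bessel_coeffs assms) simp
  also have "(\<Sum>m. ?r m * ((t / 2)\<^sup>2) ^ m) \<le> (\<Sum>m. ?r m * ((c / 2)\<^sup>2) ^ m)"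
    using t r[THEN less_imp_le]
    by (intro suminf_le summable_bessel_coeffs assms mult_left_mono power_mono) auto
  finally have J: "\<bar>bessel_J \<alpha> t\<bar> \<le> (t / 2) powr \<alpha> * (\<Sum>m. ?r m * ((c / 2)\<^sup>2) ^ m)"
    by (simp add: mult_left_mono)
  have S: "0 \<le> (\<Sum>m. ?r m * ((c / 2)\<^sup>2) ^ m)"
    using r[THEN less_imp_le] by (intro suminf_nonneg summable_bessel_coeffs assms mult_nonneg_nonneg) auto
  have "sqrt t * (t / 2) powr \<alpha> = t powr (1/2 + \<alpha>) / 2 powr \<alpha>"
    using t by (simp add: powr_add powr_half_sqrt powr_divide)
  also have "\<dots> \<le> c powr (1/2 + \<alpha>) / 2 powr \<alpha>"
    using t assms by (intro divide_right_mono powr_mono2) auto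
  finally have p: "sqrt t * (t / 2) powr \<alpha> \<le> c powr (1/2 + \<alpha>) / 2 powr \<alpha>" .
  have "\<bar>sqrt t * bessel_J \<alpha> t\<bar> \<le> sqrt t * ((t / 2) powr \<alpha> * (\<Sum>m. ?r m * ((c / 2)\<^sup>2) ^ m))"
    using J t by (simp add: abs_mult mult_left_mono)
  also have "\<dots> \<le> c powr (1/2 + \<alpha>) / 2 powr \<alpha> * (\<Sum>m. ?r m * ((c / 2)\<^sup>2) ^ m)"
    using mult_right_mono[OF p S] by (simp add: mult_ac)
  finally show "\<bar>sqrt t * bessel_J \<alpha> t\<bar> \<le> c powr (1/2 + \<alpha>) / 2 powr \<alpha> * (\<Sum>m. ?r m * ((c / 2)\<^sup>2) ^ m)" .
qed

text \<open>Up to the sign (-1)^n, this is the coefficient of (x/2)^(2 n + 2 \<alpha>) in the square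
  of \<open>bessel_J \<alpha> x\<close>.\<close>

definition bessel_sq_coeff :: "real \<Rightarrow> nat \<Rightarrow> real" where
  "bessel_sq_coeff \<alpha> n =
     Gamma (2 * real n + 2 * \<alpha> + 1) / (fact n * Gamma (n + 2 * \<alpha> + 1) * (Gamma (n + \<alpha> + 1))\<^sup>2)"

text \<open>After division by Gamma(n + \<alpha> + 1)^2, each summand is a product of two
  generalized binomials with the same upper entry n + \<alpha> and lower entries adding up to n, so
  Vandermonde's convolution sums them.\<close>

lemma bessel_square_sum:
  fixes \<alpha> :: real
  assumes "\<alpha> > -1/2"
  shows "(\<Sum>k\<le>n. rGamma (of_nat k + \<alpha> + 1) / fact k * (rGamma (of_nat (n - k) + \<alpha> + 1) / fact (n - k))) =
    bessel_sq_coeff \<alpha> n"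
proof -
  let ?G = "Gamma (n + \<alpha> + 1)"
  have G: "?G > 0" using assms by (intro Gamma_real_pos) simp
  have n: "w \<notin> \<int>\<^sub>\<le>\<^sub>0" if "w > 0" for w :: real using that nonpos_Ints_nonpos[of w] by auto
  have "rGamma (of_nat k + \<alpha> + 1) / fact k * (rGamma (of_nat (n - k) + \<alpha> + 1) / fact (n - k)) =
     ((n + \<alpha>) gchoose k) * ((n + \<alpha>) gchoose (n - k)) / ?G\<^sup>2" if k: "k \<le> n" for k
  proof -
    have "(n + \<alpha>) gchoose k = ?G * rGamma (of_nat (n - k) + \<alpha> + 1) / fact k"
      using gbinomial_Gamma[OF n, of "n + \<alpha>" k] assms k
      by (simp add: rGamma_inverse_Gamma of_nat_diff field_simps)
    moreover have "(n + \<alpha>) gchoose (n - k) = ?G * rGamma (of_nat k + \<alpha> + 1) / fact (n - k)"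
      using gbinomial_Gamma[OF n, of "n + \<alpha>" "n - k"] assms k
      by (simp add: rGamma_inverse_Gamma of_nat_diff field_simps)
    ultimately show ?thesis using G by (simp add: power2_eq_square)
  qed
  then have "(\<Sum>k\<le>n. rGamma (of_nat k + \<alpha> + 1) / fact k * (rGamma (of_nat (n - k) + \<alpha> + 1) / fact (n - k)))
     = (\<Sum>k\<in>{0..n}. ((n + \<alpha>) gchoose k) * ((n + \<alpha>) gchoose (n - k))) / ?G\<^sup>2"
    by (simp add: sum_divide_distrib atMost_atLeast0)
  also have "\<dots> = ((n + \<alpha> + (n + \<alpha>)) gchoose n) / ?G\<^sup>2"
    by (simp only: gbinomial_Vandermonde)
  also have "(n + \<alpha> + (n + \<alpha>)) gchoose n = Gamma (2 * real n + 2 * \<alpha> + 1) / (fact n * Gamma (n + 2 * \<alpha> + 1))"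
    using gbinomial_Gamma[OF n, of "n + \<alpha> + (n + \<alpha>)" n] assms by (simp add: algebra_simps)
  finally show ?thesis by (simp add: bessel_sq_coeff_def)
qed

lemma bessel_sq_coeff_nonneg: "\<alpha> > -1/2 \<Longrightarrow> bessel_sq_coeff \<alpha> n \<ge> 0"
  unfolding bessel_sq_coeff_def
  by (intro divide_nonneg_nonneg mult_nonneg_nonneg less_imp_le[OF Gamma_real_pos]) auto

text \<open>Both parts are Cauchy products: of the Bessel series with itself, and of its series of
  absolute values. The second supplies the absolute convergence required for termwise
  integration.\<close>

lemma bessel_J_square_sums:
  fixes \<alpha> x :: real
  assumes "\<alpha> > -1/2" and "x > 0"
  shows "(\<lambda>n. (-1) ^ n * bessel_sq_coeff \<alpha> n * (x / 2) powr (2 * real n + 2 * \<alpha>)) sums (bessel_J \<alpha> x)\<^sup>2"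
    and "summable (\<lambda>n. bessel_sq_coeff \<alpha> n * (x / 2) powr (2 * real n + 2 * \<alpha>))"
proof -
  define A where "A = (\<lambda>m. (-1) ^ m * rGamma (of_nat m + \<alpha> + 1) / fact m * (x / 2) powr (2 * of_nat m + \<alpha>))"
  have sn: "summable (\<lambda>m. norm (A m))" unfolding A_def by (rule summable_norm_bessel[OF assms])
  have r: "rGamma (of_nat m + \<alpha> + 1) > 0" for m using assms by (intro rGamma_pos) simp
  have eq: "A i * A (n - i) = (-1) ^ n * (x / 2) powr (2 * real n + 2 * \<alpha>) *
      (rGamma (of_nat i + \<alpha> + 1) / fact i * (rGamma (of_nat (n - i) + \<alpha> + 1) / fact (n - i)))"
    if "i \<le> n" for i n
  proof -
    have p: "(x / 2) powr (2 * of_nat i + \<alpha>) * (x / 2) powr (2 * of_nat (n - i) + \<alpha>) = (x / 2) powr (2 * real n + 2 * \<alpha>)"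
      using that by (simp flip: powr_add add: of_nat_diff algebra_simps)
    have m: "(-1::real) ^ i * (-1) ^ (n - i) = (-1) ^ n"
      using that by (simp flip: power_add)
    show ?thesis unfolding A_def p[symmetric] m[symmetric] by simp
  qed
  have s1: "(\<Sum>i\<le>n. A i * A (n - i)) = (-1) ^ n * bessel_sq_coeff \<alpha> n * (x / 2) powr (2 * real n + 2 * \<alpha>)" for n
  proof -
    have "(\<Sum>i\<le>n. A i * A (n - i)) = (\<Sum>i\<le>n. (-1) ^ n * (x / 2) powr (2 * real n + 2 * \<alpha>) *
      (rGamma (of_nat i + \<alpha> + 1) / fact i * (rGamma (of_nat (n - i) + \<alpha> + 1) / fact (n - i))))"
      by (intro sum.cong refl eq) simp
    then show ?thesis
      unfolding sum_distrib_left[symmetric] bessel_square_sum[OF assms(1)]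
      by (simp only: mult_ac)
  qed
  have s2: "(\<Sum>i\<le>n. norm (A i) * norm (A (n - i))) = bessel_sq_coeff \<alpha> n * (x / 2) powr (2 * real n + 2 * \<alpha>)" for n
  proof -
    have "norm (A i) * norm (A (n - i)) = (x / 2) powr (2 * real n + 2 * \<alpha>) *
      (rGamma (of_nat i + \<alpha> + 1) / fact i * (rGamma (of_nat (n - i) + \<alpha> + 1) / fact (n - i)))"
      if "i \<le> n" for i
      unfolding norm_mult[symmetric] eq[OF that] using r[of i] r[of "n - i"] by (simp add: abs_mult)
    then have "(\<Sum>i\<le>n. norm (A i) * norm (A (n - i))) = (\<Sum>i\<le>n. (x / 2) powr (2 * real n + 2 * \<alpha>) *
      (rGamma (of_nat i + \<alpha> + 1) / fact i * (rGamma (of_nat (n - i) + \<alpha> + 1) / fact (n - i))))"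
      by (intro sum.cong refl) simp
    then show ?thesis
      unfolding sum_distrib_left[symmetric] bessel_square_sum[OF assms(1)]
      by (simp only: mult_ac)
  qed
  show "(\<lambda>n. (-1) ^ n * bessel_sq_coeff \<alpha> n * (x / 2) powr (2 * real n + 2 * \<alpha>)) sums (bessel_J \<alpha> x)\<^sup>2"
    using Cauchy_product_sums[OF sn sn] unfolding s1 by (simp add: A_def bessel_J_def power2_eq_square)
  show "summable (\<lambda>n. bessel_sq_coeff \<alpha> n * (x / 2) powr (2 * real n + 2 * \<alpha>))"
    using Cauchy_product_sums[of "\<lambda>m. norm (A m)" "\<lambda>m. norm (A m)"] sn unfolding s2
    by (simp add: sums_iff)
qed

text \<open>The factor Gamma(n + \<alpha> + 1) is what integrating s^(n + \<alpha>) exp(-s)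
  contributes. Duplication at z = n + \<alpha> + 1/2 cancels all powers of 4 and all copies of this
  factor; the quotient Gamma(z) / Gamma(n + 2 \<alpha> + 1) that is left is a Beta value up to
  Gamma(\<alpha> + 1/2).\<close>

lemma bessel_sq_coeff_Beta:
  fixes \<alpha> a :: real
  assumes "\<alpha> > -1/2" and "a > 0"
  shows "bessel_sq_coeff \<alpha> n * (a\<^sup>2 / 4) powr (n + \<alpha>) * Gamma (n + \<alpha> + 1) =
    (a\<^sup>2) powr \<alpha> / (sqrt pi * Gamma (\<alpha> + 1/2)) * ((a\<^sup>2) ^ n / fact n * Beta (n + (\<alpha> + 1/2)) (\<alpha> + 1/2))"
proof -
  let ?z = "n + (\<alpha> + 1/2)"
  have pos: "Gamma (\<alpha> + 1/2) > 0" "Gamma (n + \<alpha> + 1) > 0" "Gamma (n + 2 * \<alpha> + 1) > 0" "Gamma ?z > 0"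
    using assms by (auto intro!: Gamma_real_pos)
  have "Gamma ?z * Gamma (?z + 1/2) = 2 powr (1 - 2 * ?z) * sqrt pi * Gamma (2 * ?z)"
    using assms by (intro Gamma_duplication_real) simp
  also have "?z + 1/2 = n + \<alpha> + 1" by simp
  also have "2 * ?z = 2 * real n + 2 * \<alpha> + 1" by simp
  also have "(2::real) powr (1 - (2 * real n + 2 * \<alpha> + 1)) = inverse (4 powr (n + \<alpha>))"
    using powr_powr[of 2 2 "n + \<alpha>"] by (simp flip: powr_minus add: algebra_simps)
  finally have dup: "Gamma (2 * real n + 2 * \<alpha> + 1) = 4 powr (n + \<alpha>) * Gamma ?z * Gamma (n + \<alpha> + 1) / sqrt pi"
    by (simp add: field_simps)
  have B: "Beta ?z (\<alpha> + 1/2) = Gamma ?z * Gamma (\<alpha> + 1/2) / Gamma (n + 2 * \<alpha> + 1)"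
    by (simp add: Beta_def algebra_simps)
  have p: "(a\<^sup>2 / 4) powr (n + \<alpha>) = (a\<^sup>2) powr \<alpha> * (a\<^sup>2) ^ n / 4 powr (n + \<alpha>)"
    using assms(2) powr_realpow[of "a\<^sup>2" n] by (simp add: powr_divide powr_add)
  show ?thesis unfolding bessel_sq_coeff_def dup B p using pos
    by (simp add: field_simps power2_eq_square)
qed

section \<open>The Weber integral of exp(-s) J(a sqrt s)^2 and its bound\<close>

lemma powr_exp_has_bochner_integral:
  fixes b z :: real
  assumes "b > 0" and "z > 0"
  shows "has_bochner_integral (restrict_space lborel {0<..}) (\<lambda>v. v powr (b - 1) * exp (- (z * v))) (Gamma b / z powr b)"
proof -
  let ?S = "{0::real<..}"
  have "has_bochner_integral lborel (\<lambda>s. indicator ?S s *\<^sub>R (s powr (b - 1) * exp (- s))) (Gamma b)"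
    using Gamma_has_bochner_integral[OF assms(1)] by (simp add: has_bochner_integral_restrict_space)
  then have "has_bochner_integral lborel
      (\<lambda>x. indicator ?S (0 + z * x) *\<^sub>R ((0 + z * x) powr (b - 1) * exp (- (0 + z * x)))) (Gamma b /\<^sub>R \<bar>z\<bar>)"
    using assms(2) by (subst (asm) lborel_has_bochner_integral_real_affine_iff[where c = z and t = 0]) auto
  also have "(\<lambda>x. indicator ?S (0 + z * x) *\<^sub>R ((0 + z * x) powr (b - 1) * exp (- (0 + z * x))))
     = (\<lambda>x. z powr (b - 1) * (indicator ?S x *\<^sub>R (x powr (b - 1) * exp (- (z * x)))))"
    using assms(2) by (auto simp: zero_less_mult_iff indicator_def powr_mult)
  \<comment> \<open>The substitution s = z x leaves a factor z^(b - 1) in the integrand, which is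
    divided out here.\<close>
  finally have "has_bochner_integral lborel (\<lambda>x. 1 / z powr (b - 1) *
      (z powr (b - 1) * (indicator ?S x *\<^sub>R (x powr (b - 1) * exp (- (z * x)))))) (1 / z powr (b - 1) * (Gamma b /\<^sub>R \<bar>z\<bar>))"
    by (rule has_bochner_integral_mult_right)
  also have "(\<lambda>x. 1 / z powr (b - 1) * (z powr (b - 1) * (indicator ?S x *\<^sub>R (x powr (b - 1) * exp (- (z * x))))))
     = (\<lambda>x. indicator ?S x *\<^sub>R (x powr (b - 1) * exp (- (z * x))))"
    using assms(2) by simp
  also have "1 / z powr (b - 1) * (Gamma b /\<^sub>R \<bar>z\<bar>) = Gamma b / z powr b"
    using assms(2) by (simp add: powr_diff divide_inverse)
  finally show ?thesis by (simp add: has_bochner_integral_restrict_space)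
qed

lemma unit_measure_powr_exp_le:
  fixes b z :: real
  assumes "b > 0" and "z > 0"
  shows "integrable unit_measure (\<lambda>v. v powr (b - 1) * exp (- (z * v)))"
    and "(\<integral>v. v powr (b - 1) * exp (- (z * v)) \<partial>unit_measure) \<le> Gamma b / z powr b"
proof -
  let ?f = "\<lambda>v. v powr (b - 1) * exp (- (z * v))"
  have I: "set_integrable lborel {0<..} ?f" "(LINT v:{0<..}|lborel. ?f v) = Gamma b / z powr b"
    using powr_exp_has_bochner_integral[OF assms]
    by (auto simp: has_bochner_integral_iff set_integrable_def set_lebesgue_integral_def
        integrable_restrict_space integral_restrict_space)
  have J: "set_integrable lborel {0<..<1} ?f"
    by (rule set_integrable_subset[OF I(1)]) auto
  then show "integrable unit_measure ?f"
    by (simp add: unit_measure_def integrable_restrict_space set_integrable_def)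
  have "(\<integral>v. ?f v \<partial>unit_measure) = (LINT v:{0<..<1}|lborel. ?f v)"
    by (simp add: unit_measure_def integral_restrict_space set_lebesgue_integral_def)
  also have "\<dots> \<le> (LINT v:{0<..}|lborel. ?f v)"
    using I(1) J unfolding set_integrable_def set_lebesgue_integral_def
    by (intro integral_mono) (auto simp: indicator_def)
  finally show "(\<integral>v. ?f v \<partial>unit_measure) \<le> Gamma b / z powr b" using I(2) by simp
qed

lemma unit_measure_reflect:
  fixes f :: "real \<Rightarrow> real"
  shows "(\<integral>v. f (1 - v) \<partial>unit_measure) = (\<integral>v. f v \<partial>unit_measure)"
    and "integrable unit_measure (\<lambda>v. f (1 - v)) \<longleftrightarrow> integrable unit_measure f"
proof -
  have eq: "indicator {0<..<1} (1 - v) = (indicator {0<..<1} v :: real)" for v :: real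
    by (auto simp: indicator_def)
  show "(\<integral>v. f (1 - v) \<partial>unit_measure) = (\<integral>v. f v \<partial>unit_measure)"
    using lborel_integral_real_affine[of "-1" "\<lambda>v. indicator {0<..<1} v *\<^sub>R f v" 1] eq
    by (simp add: unit_measure_def integral_restrict_space)
  show "integrable unit_measure (\<lambda>v. f (1 - v)) \<longleftrightarrow> integrable unit_measure f"
    using lborel_integrable_real_affine_iff[of "-1" "\<lambda>v. indicator {0<..<1} v *\<^sub>R f v" 1] eq
    by (simp add: unit_measure_def integrable_restrict_space)
qed

text \<open>One of v and 1 - v is at least 1/2, and its power b - 1 is at most 2 because b - 1 > -1.
  On the right half, reflecting v to 1 - v only increases the exponential. Hence the integrand is
  below 2 h(v) + 2 h(1 - v), and each copy of h integrates to at most the full Gamma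
  integral.\<close>

lemma Beta_exp_integral_le:
  fixes b z :: real
  assumes b: "b > 0" and z: "z > 0"
  shows "(\<integral>v. exp (- (z * v)) * (v powr (b - 1) * (1 - v) powr (b - 1)) \<partial>unit_measure) \<le> 4 * Gamma b / z powr b"
    (is "integral\<^sup>L _ ?f \<le> _")
proof -
  define h where "h = (\<lambda>v. v powr (b - 1) * exp (- (z * v)))"
  have int_h: "integrable unit_measure h" and h_le: "integral\<^sup>L unit_measure h \<le> Gamma b / z powr b"
    using unit_measure_powr_exp_le[OF assms] by (simp_all add: h_def)
  have two: "v powr (b - 1) \<le> 2" if "1/2 \<le> v" "v \<le> 1" for v
  proof (cases "b \<ge> 1")
    case True
    then show ?thesis using that powr_mono2[of "b-1" v 1] by simp
  next
    case False
    then have "v powr (b - 1) \<le> (1/2) powr (b - 1)" using that by (intro powr_mono2') auto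
    also have "\<dots> \<le> (1/2) powr (-1)" using b by (intro powr_mono') auto
    finally show ?thesis by (simp add: powr_minus)
  qed
  have pw: "0 \<le> ?f v \<and> ?f v \<le> 2 * h v + 2 * h (1 - v)" if "0 < v" "v < 1" for v
  proof (cases "v \<le> 1/2")
    case True
    have "(1 - v) powr (b - 1) \<le> 2" using True that by (intro two) auto
    then have "h v * (1 - v) powr (b - 1) \<le> h v * 2" by (intro mult_left_mono) (auto simp: h_def)
    moreover have "h (1 - v) \<ge> 0" by (simp add: h_def)
    ultimately have "h v * (1 - v) powr (b - 1) \<le> 2 * h v + 2 * h (1 - v)" by linarith
    then show ?thesis by (simp add: h_def mult_ac)
  next
    case False
    have "v powr (b - 1) \<le> 2" using False that by (intro two) auto
    moreover have "exp (- (z * v)) \<le> exp (- (z * (1 - v)))" using False z by simp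
    ultimately have "v powr (b - 1) * (exp (- (z * v)) * (1 - v) powr (b - 1))
        \<le> 2 * (exp (- (z * (1 - v))) * (1 - v) powr (b - 1))"
      by (intro mult_mono) auto
    then have "?f v \<le> 2 * h (1 - v)" by (simp add: h_def mult_ac)
    moreover have "h v \<ge> 0" "?f v \<ge> 0" by (simp_all add: h_def)
    ultimately show ?thesis by linarith
  qed
  have int2: "integrable unit_measure (\<lambda>v. 2 * h v + 2 * h (1 - v))"
    using int_h unit_measure_reflect(2)[of h] by simp
  have "integral\<^sup>L unit_measure ?f \<le> (\<integral>v. 2 * h v + 2 * h (1 - v) \<partial>unit_measure)"
  proof (rule integral_mono)
    show "integrable unit_measure ?f"
      by (rule Bochner_Integration.integrable_bound[OF int2])
        (use pw in \<open>auto intro!: AE_I2 measurable_unit_measure order_trans[OF _ abs_ge_self] simp: space_unit_measure\<close>)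
  qed (use pw int2 in \<open>auto simp: space_unit_measure\<close>)
  also have "\<dots> = 4 * integral\<^sup>L unit_measure h"
    using int_h unit_measure_reflect[of h] by simp
  finally show ?thesis using h_le by simp
qed

text \<open>Both integrals expand into the same alternating series with terms
  \<open>K * ((-1) ^ n * w n)\<close>: the left one through the power series of J^2, the right one
  through that of exp(-a^2 v). The summability of \<open>w\<close> justifies both interchanges of
  sum and integral.\<close>

lemma bessel_J_square_exp_integral:
  fixes \<alpha> a :: real
  assumes \<alpha>: "\<alpha> > -1/2" and a: "a > 0"
  defines "b \<equiv> \<alpha> + 1/2"
  shows "integrable (restrict_space lborel {0<..}) (\<lambda>s. exp (- s) * (bessel_J \<alpha> (a * sqrt s))\<^sup>2)"
    and "(\<integral>s. exp (- s) * (bessel_J \<alpha> (a * sqrt s))\<^sup>2 \<partial>restrict_space lborel {0<..}) =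
       (a\<^sup>2) powr \<alpha> / (sqrt pi * Gamma b) *
         (\<integral>v. exp (- (a\<^sup>2 * v)) * (v powr (b - 1) * (1 - v) powr (b - 1)) \<partial>unit_measure)"
proof -
  have b: "b > 0" using \<alpha> by (simp add: b_def)
  define M where "M = restrict_space lborel {0::real<..}"
  define K where "K = (a\<^sup>2) powr \<alpha> / (sqrt pi * Gamma b)"
  define w where "w = (\<lambda>n. (a\<^sup>2) ^ n / fact n * Beta (n + b) b)"
  \<comment> \<open>\<open>f n\<close> and \<open>g n\<close> are the terms of the two expansions.
    The exponents \<open>n + \<alpha> + 1 - 1\<close> and \<open>n + b - 1\<close> are left
    unsimplified to match the Gamma and Beta integrals literally.\<close>
  define f where "f = (\<lambda>n s. (-1) ^ n * (bessel_sq_coeff \<alpha> n * (a\<^sup>2 / 4) powr (n + \<alpha>)) *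
    (s powr (n + \<alpha> + 1 - 1) * exp (- s)))"
  define g where "g = (\<lambda>n v. ((-1) ^ n * (a\<^sup>2) ^ n / fact n) * (v powr (n + b - 1) * (1 - v) powr (b - 1)))"
  have B_nonneg: "Beta x y \<ge> 0" if "x > 0" "y > 0" for x y :: real
    unfolding Beta_def using that by (simp add: Gamma_real_pos less_imp_le)
  have Kw: "bessel_sq_coeff \<alpha> n * (a\<^sup>2 / 4) powr (n + \<alpha>) * Gamma (n + \<alpha> + 1) = K * w n" for n
    using bessel_sq_coeff_Beta[OF \<alpha> a, of n] by (simp add: K_def w_def b_def)
  \<comment> \<open>Beta decreases in its first argument, so \<open>w\<close> is dominated by a
    multiple of the exponential series at a^2.\<close>
  have w_le: "Beta (n + b) b \<le> Beta b b" for n :: nat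
    using b by (intro Beta_real_mono) auto
  have w_nn: "w n \<ge> 0" for n
    unfolding w_def using b by (intro mult_nonneg_nonneg B_nonneg) auto
  have sum_w: "summable w"
  proof (rule summable_comparison_test')
    show "summable (\<lambda>n. Beta b b * ((a\<^sup>2) ^ n / fact n))"
      using summable_exp_generic[of "a\<^sup>2"] by (intro summable_mult) (simp add: scaleR_conv_of_real field_simps)
    show "norm (w n) \<le> Beta b b * ((a\<^sup>2) ^ n / fact n)" for n
      using w_nn[of n] mult_left_mono[OF w_le[of n], of "(a\<^sup>2) ^ n / fact n"] by (simp add: w_def mult.commute)
  qed

  have f_int: "has_bochner_integral M (f n) ((-1) ^ n * (K * w n))" for n
  proof -
    have "has_bochner_integral M (f n) ((-1) ^ n * (bessel_sq_coeff \<alpha> n * (a\<^sup>2 / 4) powr (n + \<alpha>)) * Gamma (n + \<alpha> + 1))"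
      unfolding f_def M_def using \<alpha> by (intro has_bochner_integral_mult_right Gamma_has_bochner_integral) auto
    then show ?thesis using Kw[of n] by (simp add: mult.assoc)
  qed
  \<comment> \<open>The sign of a term depends on n alone, so the integral of its norm follows from
    \<open>f_int\<close> without a new computation.\<close>
  have nf: "norm (f n s) = (-1) ^ n * f n s" for n s
    using bessel_sq_coeff_nonneg[OF \<alpha>, of n] by (simp add: f_def abs_mult flip: power_mult_distrib mult.assoc)
  have nf_int: "(\<integral>s. norm (f n s) \<partial>M) = K * w n" for n
    using has_bochner_integral_integral_eq[OF f_int[of n]] unfolding nf
    by (simp flip: power_mult_distrib mult.assoc)
  have fs: "f n s = exp (- s) * ((-1) ^ n * bessel_sq_coeff \<alpha> n * (a * sqrt s / 2) powr (2 * real n + 2 * \<alpha>))"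
    if "s > 0" for n s
  proof -
    have "(a * sqrt s / 2) powr (2 * real n + 2 * \<alpha>) = ((a * sqrt s / 2) powr 2) powr (n + \<alpha>)"
      by (simp add: powr_powr distrib_left)
    also have "(a * sqrt s / 2) powr 2 = a\<^sup>2 / 4 * s"
      using that a by (simp add: powr_numeral power_mult_distrib power_divide)
    also have "(a\<^sup>2 / 4 * s) powr (n + \<alpha>) = (a\<^sup>2 / 4) powr (n + \<alpha>) * s powr (n + \<alpha>)"
      using that powr_mult[of "a\<^sup>2 / 4" s] by simp
    finally show ?thesis by (simp add: f_def mult_ac)
  qed
  have f_sums: "(\<lambda>n. f n s) sums (exp (- s) * (bessel_J \<alpha> (a * sqrt s))\<^sup>2)" if "s > 0" for s
    unfolding fs[OF that] using that a by (intro sums_mult bessel_J_square_sums(1)[OF \<alpha>]) auto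
  have f_abs: "summable (\<lambda>n. norm (f n s))" if "s > 0" for s
  proof -
    have "norm (f n s) = exp (- s) * (bessel_sq_coeff \<alpha> n * (a * sqrt s / 2) powr (2 * real n + 2 * \<alpha>))" for n
      unfolding fs[OF that] using bessel_sq_coeff_nonneg[OF \<alpha>, of n] by (simp add: abs_mult)
    then show ?thesis using that a by (simp only:) (intro summable_mult bessel_J_square_sums(2)[OF \<alpha>], auto)
  qed
  have f1: "integrable M (f n)" for n using f_int[of n] by (simp add: has_bochner_integral_iff)
  have f2: "AE s in M. summable (\<lambda>n. norm (f n s))"
    using f_abs by (intro AE_I2) (simp add: M_def space_restrict_space)
  have f3: "summable (\<lambda>n. \<integral>s. norm (f n s) \<partial>M)"
    unfolding nf_int by (intro summable_mult sum_w)
  have f_suminf: "(\<Sum>n. f n s) = exp (- s) * (bessel_J \<alpha> (a * sqrt s))\<^sup>2" if "s \<in> space M" for s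
    using f_sums that by (intro sums_unique[symmetric]) (simp add: M_def space_restrict_space)
  have "integrable M (\<lambda>s. \<Sum>n. f n s)" by (rule integrable_suminf[OF f1 f2 f3])
  then show "integrable M (\<lambda>s. exp (- s) * (bessel_J \<alpha> (a * sqrt s))\<^sup>2)"
    by (simp add: f_suminf cong: Bochner_Integration.integrable_cong)
  have "(\<lambda>n. integral\<^sup>L M (f n)) sums (\<integral>s. (\<Sum>n. f n s) \<partial>M)" by (rule sums_integral[OF f1 f2 f3])
  also have "(\<integral>s. (\<Sum>n. f n s) \<partial>M) = (\<integral>s. exp (- s) * (bessel_J \<alpha> (a * sqrt s))\<^sup>2 \<partial>M)"
    by (intro Bochner_Integration.integral_cong refl f_suminf)
  also have "(\<lambda>n. integral\<^sup>L M (f n)) = (\<lambda>n. K * ((-1) ^ n * w n))"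
    using has_bochner_integral_integral_eq[OF f_int] by (simp add: mult_ac)
  finally have F: "(\<lambda>n. K * ((-1) ^ n * w n)) sums (\<integral>s. exp (- s) * (bessel_J \<alpha> (a * sqrt s))\<^sup>2 \<partial>M)" .

  \<comment> \<open>The same scheme for the right-hand side, now with Beta integrals over
    (0,1).\<close>
  have g_int: "has_bochner_integral unit_measure (g n) ((-1) ^ n * w n)" for n
  proof -
    have "has_bochner_integral unit_measure (g n) (((-1) ^ n * (a\<^sup>2) ^ n / fact n) * Beta (n + b) b)"
      unfolding g_def using b by (intro has_bochner_integral_mult_right Beta_has_bochner_integral) auto
    then show ?thesis by (simp add: w_def mult.assoc)
  qed
  have ng: "norm (g n v) = (-1) ^ n * g n v" for n v
    by (simp add: g_def abs_mult flip: power_mult_distrib mult.assoc)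
  have ng_int: "(\<integral>v. norm (g n v) \<partial>unit_measure) = w n" for n
    using has_bochner_integral_integral_eq[OF g_int[of n]] unfolding ng
    by (simp flip: power_mult_distrib mult.assoc)
  have gs: "g n v = (v powr (b - 1) * (1 - v) powr (b - 1)) * ((- (a\<^sup>2 * v)) ^ n / fact n)" if "v > 0" for n v
  proof -
    have "v powr (n + b - 1) = v ^ n * v powr (b - 1)"
      using that powr_realpow[of v n] powr_add[of v n "b - 1"] by (simp add: add_diff_eq)
    then show ?thesis by (simp add: g_def power_mult_distrib power_minus[of "a\<^sup>2 * v"])
  qed
  have ex: "(\<lambda>n. y ^ n / fact n) sums exp y" for y :: real
    using exp_converges[of y] by (simp add: scaleR_conv_of_real field_simps)
  have g_sums: "(\<lambda>n. g n v) sums (exp (- (a\<^sup>2 * v)) * (v powr (b - 1) * (1 - v) powr (b - 1)))" if "v > 0" for v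
    unfolding gs[OF that] mult.commute[of "exp _"] by (intro sums_mult ex)
  have g_abs: "summable (\<lambda>n. norm (g n v))" if "v > 0" for v
  proof -
    have "norm (g n v) = (v powr (b - 1) * (1 - v) powr (b - 1)) * ((a\<^sup>2 * v) ^ n / fact n)" for n
      unfolding gs[OF that] using that by (simp add: abs_mult power_abs)
    then show ?thesis by (simp only:) (intro summable_mult sums_summable[OF ex])
  qed
  have g1: "integrable unit_measure (g n)" for n using g_int[of n] by (simp add: has_bochner_integral_iff)
  have g2: "AE s in unit_measure. summable (\<lambda>n. norm (g n s))"
    using g_abs by (intro AE_I2) (simp add: space_unit_measure)
  have g3: "summable (\<lambda>n. \<integral>s. norm (g n s) \<partial>unit_measure)"
    unfolding ng_int by (rule sum_w)
  have "(\<lambda>n. integral\<^sup>L unit_measure (g n)) sums (\<integral>v. (\<Sum>n. g n v) \<partial>unit_measure)"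
    by (rule sums_integral[OF g1 g2 g3])
  also have "(\<integral>v. (\<Sum>n. g n v) \<partial>unit_measure) =
      (\<integral>v. exp (- (a\<^sup>2 * v)) * (v powr (b - 1) * (1 - v) powr (b - 1)) \<partial>unit_measure)"
    using g_sums by (intro Bochner_Integration.integral_cong refl sums_unique[symmetric]) (simp add: space_unit_measure)
  also have "(\<lambda>n. integral\<^sup>L unit_measure (g n)) = (\<lambda>n. (-1) ^ n * w n)"
    using has_bochner_integral_integral_eq[OF g_int] by simp
  finally show "(\<integral>s. exp (- s) * (bessel_J \<alpha> (a * sqrt s))\<^sup>2 \<partial>M) =
       (a\<^sup>2) powr \<alpha> / (sqrt pi * Gamma b) *
         (\<integral>v. exp (- (a\<^sup>2 * v)) * (v powr (b - 1) * (1 - v) powr (b - 1)) \<partial>unit_measure)"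
    using sums_unique2[OF F sums_mult] unfolding K_def by blast
qed

text \<open>With z = a^2 in the Beta estimate, Gamma(b) cancels, and b = \<alpha> + 1/2 leaves a
  single power of a in the denominator.\<close>

lemma bessel_J_square_exp_integral_le:
  fixes \<alpha> a :: real
  assumes \<alpha>: "\<alpha> > -1/2" and a: "a > 0"
  shows "(\<integral>s. exp (- s) * (bessel_J \<alpha> (a * sqrt s))\<^sup>2 \<partial>restrict_space lborel {0<..}) \<le> 4 / (sqrt pi * a)"
proof -
  define b where "b = \<alpha> + 1/2"
  have b: "b > 0" "Gamma b > 0" using \<alpha> by (simp_all add: b_def Gamma_real_pos)
  have "(\<integral>s. exp (- s) * (bessel_J \<alpha> (a * sqrt s))\<^sup>2 \<partial>restrict_space lborel {0<..})
     \<le> (a\<^sup>2) powr \<alpha> / (sqrt pi * Gamma b) * (4 * Gamma b / (a\<^sup>2) powr b)"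
    unfolding bessel_J_square_exp_integral(2)[OF assms] b_def
    using \<alpha> a b by (intro mult_left_mono Beta_exp_integral_le) (auto simp: b_def)
  also have "(a\<^sup>2) powr b = (a\<^sup>2) powr \<alpha> * a"
    using a by (simp add: b_def powr_add powr_half_sqrt)
  finally show ?thesis using a b by (simp add: field_simps)
qed

text \<open>The factor a / 2 from the substitution cancels the 1 / a of the Weber bound, so the
  result 2 e / sqrt \<pi> is uniform in a and \<alpha>.\<close>

lemma bessel_kernel_square_nn_integral_le:
  fixes \<alpha> a :: real
  assumes \<alpha>: "\<alpha> > -1/2" and a: "a > 0"
  shows "(\<integral>\<^sup>+y. ennreal ((sqrt (a * y) * bessel_J \<alpha> (a * y))\<^sup>2) \<partial>unit_measure) \<le> 4"
proof -
  define F where "F = (\<lambda>s. (bessel_J \<alpha> (a * sqrt s))\<^sup>2)"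
  have [measurable]: "F \<in> borel_measurable borel" unfolding F_def by measurable
  let ?W = "\<integral>s. exp (- s) * F s \<partial>restrict_space lborel {0<..}"
  have "(\<integral>\<^sup>+y. ennreal ((sqrt (a * y) * bessel_J \<alpha> (a * y))\<^sup>2) \<partial>unit_measure)
     = (\<integral>\<^sup>+y. ennreal ((sqrt (a * y) * bessel_J \<alpha> (a * y))\<^sup>2) * indicator {0<..<1} y \<partial>lborel)"
    unfolding unit_measure_def by (intro nn_integral_restrict_space) simp
  \<comment> \<open>The integrand a y J(a y)^2 is split so that 2 y appears as the derivative of
    y^2.\<close>
  also have "\<dots> \<le> (\<integral>\<^sup>+y. ennreal (a / 2) * (ennreal (F (y\<^sup>2)) * ennreal (2 * y) * indicator {0..1} y) \<partial>lborel)"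
    using a by (intro nn_integral_mono)
      (auto simp: F_def indicator_def power_mult_distrib simp flip: ennreal_mult)
  also have "\<dots> = ennreal (a / 2) * (\<integral>\<^sup>+y. ennreal (F (y\<^sup>2)) * ennreal (2 * y) * indicator {0..1} y \<partial>lborel)"
    by (intro nn_integral_cmult) measurable
  also have "(\<integral>\<^sup>+y. ennreal (F (y\<^sup>2)) * ennreal (2 * y) * indicator {0..1} y \<partial>lborel)
     = (\<integral>\<^sup>+y. ennreal (F (y\<^sup>2) * (2 * y) * indicator {0..1} y) \<partial>lborel)"
    by (intro nn_integral_cong) (auto simp: F_def indicator_def simp flip: ennreal_mult)
  also have "\<dots> = (\<integral>\<^sup>+s. ennreal (F s * indicator {0\<^sup>2..1\<^sup>2} s) \<partial>lborel)"
    by (intro nn_integral_substitution[where g = "\<lambda>y. y\<^sup>2", symmetric])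
      (auto intro!: derivative_eq_intros continuous_intros simp: set_borel_measurable_def)
  also have "\<dots> \<le> (\<integral>\<^sup>+s. ennreal (exp 1 * (exp (- s) * F s)) * indicator {0<..} s \<partial>lborel)"
  proof (intro nn_integral_mono)
    fix s :: real
    \<comment> \<open>The closed interval of the substitution contains 0, the half-line {0<..} does
      not; the default value 0 of \<open>bessel_J\<close> at 0 settles this point.\<close>
    have "F 0 = 0" by (simp add: F_def bessel_J_def)
    moreover have "F s \<le> exp 1 * (exp (- s) * F s)" if "s \<le> 1"
    proof -
      have "1 \<le> exp (1 - s)" using that by simp
      from mult_right_mono[OF this, of "F s"] show ?thesis by (simp add: F_def exp_diff exp_minus field_simps)
    qed
    ultimately show "ennreal (F s * indicator {0\<^sup>2..1\<^sup>2} s) \<le> ennreal (exp 1 * (exp (- s) * F s)) * indicator {0<..} s"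
      by (cases "s = 0") (auto simp: indicator_def intro!: ennreal_leI)
  qed
  also have "\<dots> = (\<integral>\<^sup>+s. ennreal (exp 1 * (exp (- s) * F s)) \<partial>restrict_space lborel {0<..})"
    by (subst nn_integral_restrict_space) auto
  also have "\<dots> = ennreal (\<integral>s. exp 1 * (exp (- s) * F s) \<partial>restrict_space lborel {0<..})"
    using bessel_J_square_exp_integral(1)[OF assms]
    by (intro nn_integral_eq_integral integrable_mult_right AE_I2) (auto simp: F_def)
  also have "\<dots> = ennreal (exp 1 * ?W)" by simp
  also have "ennreal (a / 2) * ennreal (exp 1 * ?W) = ennreal (a / 2 * (exp 1 * ?W))"
    using a by (intro ennreal_mult[symmetric] mult_nonneg_nonneg integral_nonneg_AE AE_I2) (auto simp: F_def)
  also have "\<dots> \<le> ennreal 4"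
  proof (intro ennreal_leI)
    \<comment> \<open>The constant 4 comes from e \<le> 3 and sqrt \<pi> \<ge> 3/2: 2 e / sqrt \<pi>
      \<le> 6 / (3/2).\<close>
    have e3: "exp 1 \<le> (3::real)" by (rule exp_le)
    have "sqrt (9/4) \<le> sqrt pi" using pi_gt3 by (intro real_sqrt_le_mono) simp
    then have sp: "3/2 \<le> sqrt pi" by (simp add: real_sqrt_divide)
    have "a / 2 * (exp 1 * ?W) \<le> a / 2 * (3 * (4 / (sqrt pi * a)))"
      using e3 bessel_J_square_exp_integral_le[OF assms] a
      by (intro mult_left_mono mult_mono integral_nonneg_AE AE_I2) (auto simp: F_def)
    also have "\<dots> = 6 / sqrt pi" using a by simp
    also have "\<dots> \<le> 4" using sp by (simp add: field_simps)
    finally show "a / 2 * (exp 1 * ?W) \<le> 4" .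
  qed
  finally show ?thesis by (simp add: mult_left_mono)
qed

subsection \<open>Orthonormal families of square integrable functions\<close>

definition L2_fun :: "'a measure \<Rightarrow> ('a \<Rightarrow> real) set" where
  "L2_fun M = {f \<in> borel_measurable M. integrable M (\<lambda>x. (f x)\<^sup>2)}"

definition L2_inner :: "'a measure \<Rightarrow> ('a \<Rightarrow> real) \<Rightarrow> ('a \<Rightarrow> real) \<Rightarrow> real" where
  "L2_inner M f g = (\<integral>x. f x * g x \<partial>M)"

lemma L2_fun_measurable: "f \<in> L2_fun M \<Longrightarrow> f \<in> borel_measurable M"
  by (simp add: L2_fun_def)

lemma L2_fun_mult_integrable:
  assumes "f \<in> L2_fun M" "g \<in> L2_fun M"
  shows "integrable M (\<lambda>x. f x * g x)"
proof (rule Bochner_Integration.integrable_bound)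
  show "integrable M (\<lambda>x. (f x)\<^sup>2 + (g x)\<^sup>2)" using assms by (simp add: L2_fun_def)
  show "(\<lambda>x. f x * g x) \<in> borel_measurable M" using assms by (auto simp: L2_fun_def)
  have "\<bar>u * v\<bar> \<le> u\<^sup>2 + v\<^sup>2" for u v :: real
  proof -
    have "2 * \<bar>u * v\<bar> \<le> u\<^sup>2 + v\<^sup>2"
      using sum_squares_bound[of "\<bar>u\<bar>" "\<bar>v\<bar>"] by (simp add: abs_mult mult.assoc)
    then show ?thesis using abs_ge_zero[of "u * v"] by linarith
  qed
  then show "AE x in M. norm (f x * g x) \<le> norm ((f x)\<^sup>2 + (g x)\<^sup>2)" by simp
qed

lemma L2_fun_scale: "f \<in> L2_fun M \<Longrightarrow> (\<lambda>x. c * f x) \<in> L2_fun M"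
  by (auto simp: L2_fun_def power_mult_distrib)

lemma L2_fun_add:
  assumes "f \<in> L2_fun M" "g \<in> L2_fun M"
  shows "(\<lambda>x. f x + g x) \<in> L2_fun M"
  using assms L2_fun_mult_integrable[OF assms] by (auto simp add: L2_fun_def power2_sum mult.assoc)

lemma L2_fun_sum:
  assumes "\<And>i. i \<in> I \<Longrightarrow> f i \<in> L2_fun M"
  shows "(\<lambda>x. \<Sum>i\<in>I. f i x) \<in> L2_fun M"
  using assms
proof (induction I rule: infinite_finite_induct)
  case (insert i I)
  then show ?case using L2_fun_add[of "f i" M "\<lambda>x. \<Sum>i\<in>I. f i x"] by simp
qed (simp_all add: L2_fun_def)

lemma L2_fun_lincomb:
  assumes "\<And>i. i \<in> I \<Longrightarrow> f i \<in> L2_fun M"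
  shows "(\<lambda>x. \<Sum>i\<in>I. a i * f i x) \<in> L2_fun M"
  using assms by (intro L2_fun_sum L2_fun_scale)

lemma L2_fun_diff:
  assumes "f \<in> L2_fun M" "g \<in> L2_fun M"
  shows "(\<lambda>x. f x - g x) \<in> L2_fun M"
  using L2_fun_add[OF assms(1) L2_fun_scale[OF assms(2), of "-1"]] by simp

lemma L2_inner_commute: "L2_inner M f g = L2_inner M g f"
  by (simp add: L2_inner_def mult.commute)

lemma L2_inner_scale_left: "L2_inner M (\<lambda>x. c * f x) g = c * L2_inner M f g"
  by (simp add: L2_inner_def mult.assoc)

lemma L2_inner_lincomb_left:
  assumes "\<And>i. i \<in> I \<Longrightarrow> f i \<in> L2_fun M" "g \<in> L2_fun M"
  shows "L2_inner M (\<lambda>x. \<Sum>i\<in>I. a i * f i x) g = (\<Sum>i\<in>I. a i * L2_inner M (f i) g)"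
  using assms by (simp add: L2_inner_def sum_distrib_right mult.assoc L2_fun_mult_integrable)

lemma L2_inner_diff_left:
  assumes "f \<in> L2_fun M" "g \<in> L2_fun M" "h \<in> L2_fun M"
  shows "L2_inner M (\<lambda>x. f x - g x) h = L2_inner M f h - L2_inner M g h"
  using assms by (simp add: L2_inner_def left_diff_distrib L2_fun_mult_integrable)

lemma L2_inner_nonneg: "L2_inner M f f \<ge> 0"
  by (simp add: L2_inner_def)

lemma L2_inner_cong_AE:
  assumes "AE x in M. f x = f' x" "f \<in> borel_measurable M" "f' \<in> borel_measurable M" "g \<in> borel_measurable M"
  shows "L2_inner M f g = L2_inner M f' g"
  unfolding L2_inner_def using assms by (intro integral_cong_AE) auto

lemma L2_inner_self_eq_0:
  assumes "f \<in> L2_fun M" "L2_inner M f f = 0"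
  shows "AE x in M. f x = 0"
  using assms integral_nonneg_eq_0_iff_AE[of M "\<lambda>x. f x * f x"]
  by (simp add: L2_inner_def L2_fun_mult_integrable)

text \<open>The index type is left free because eigenfunctions are later indexed by pairs of an
  eigenvalue and a position in its eigenspace.\<close>

definition L2_orthonormal :: "'a measure \<Rightarrow> ('i \<Rightarrow> 'a \<Rightarrow> real) \<Rightarrow> 'i set \<Rightarrow> bool" where
  "L2_orthonormal M e I \<longleftrightarrow> (\<forall>i\<in>I. e i \<in> L2_fun M) \<and>
     (\<forall>i\<in>I. \<forall>j\<in>I. L2_inner M (e i) (e j) = (if i = j then 1 else 0))"

text \<open>Subtracting the orthogonal projection serves two purposes: nonnegativity of the squared
  norm of \<open>r\<close> is Bessel's inequality, and orthogonality of \<open>r\<close> is the step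
  of Gram-Schmidt.\<close>

lemma orthonormal_residual:
  assumes e: "L2_orthonormal M e I" and "finite I" and g: "g \<in> L2_fun M"
  defines "r \<equiv> (\<lambda>x. g x - (\<Sum>i\<in>I. L2_inner M g (e i) * e i x))"
  shows "r \<in> L2_fun M" and "\<And>j. j \<in> I \<Longrightarrow> L2_inner M r (e j) = 0"
    and "L2_inner M r r = L2_inner M g g - (\<Sum>i\<in>I. (L2_inner M g (e i))\<^sup>2)"
proof -
  have eL: "\<And>i. i \<in> I \<Longrightarrow> e i \<in> L2_fun M"
    and on: "\<And>i j. i \<in> I \<Longrightarrow> j \<in> I \<Longrightarrow> L2_inner M (e i) (e j) = (if i = j then 1 else 0)"
    using e by (auto simp: L2_orthonormal_def)
  let ?p = "\<lambda>x. \<Sum>i\<in>I. L2_inner M g (e i) * e i x"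
  have p: "?p \<in> L2_fun M" using eL by (rule L2_fun_lincomb)
  show r: "r \<in> L2_fun M" unfolding r_def by (rule L2_fun_diff[OF g p])
  show orth: "L2_inner M r (e j) = 0" if "j \<in> I" for j
  proof -
    have "L2_inner M ?p (e j) = (\<Sum>i\<in>I. L2_inner M g (e i) * L2_inner M (e i) (e j))"
      using eL that by (intro L2_inner_lincomb_left) auto
    also have "\<dots> = (\<Sum>i\<in>I. if i = j then L2_inner M g (e j) else 0)"
      using on that by (intro sum.cong) auto
    also have "\<dots> = L2_inner M g (e j)" using that \<open>finite I\<close> by simp
    finally show ?thesis unfolding r_def using L2_inner_diff_left[OF g p eL[OF that]] by simp
  qed
  \<comment> \<open>The projection is orthogonal to \<open>r\<close>, so the squared norm of
    \<open>r\<close> equals the inner product of \<open>r\<close> with \<open>g\<close>.\<close>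
  have "L2_inner M ?p r = (\<Sum>i\<in>I. L2_inner M g (e i) * L2_inner M (e i) r)"
    using eL r by (intro L2_inner_lincomb_left)
  also have "\<dots> = 0" using orth by (intro sum.neutral) (simp add: L2_inner_commute[of _ _ r])
  finally have "L2_inner M r r = L2_inner M g r"
    using L2_inner_diff_left[OF g p r] unfolding r_def by simp
  also have "\<dots> = L2_inner M g g - L2_inner M ?p g"
    using L2_inner_diff_left[OF g p g] unfolding r_def by (simp add: L2_inner_commute[of _ g "\<lambda>x. g x - _ x"])
  also have "L2_inner M ?p g = (\<Sum>i\<in>I. (L2_inner M g (e i))\<^sup>2)"
    using L2_inner_lincomb_left[of I e M g "\<lambda>i. L2_inner M g (e i)"] eL g
    by (simp add: power2_eq_square L2_inner_commute[of _ "e _" g])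
  finally show "L2_inner M r r = L2_inner M g g - (\<Sum>i\<in>I. (L2_inner M g (e i))\<^sup>2)" .
qed

lemma L2_bessel_inequality:
  assumes "L2_orthonormal M e I" and "finite I" and "g \<in> L2_fun M"
  shows "(\<Sum>i\<in>I. (L2_inner M g (e i))\<^sup>2) \<le> L2_inner M g g"
  using orthonormal_residual(3)[OF assms] L2_inner_nonneg by (smt (verit))

text \<open>The second assumption is linear independence modulo null sets; it keeps the residual
  away from norm 0, so that it can be normalized. The new functions are combinations of the old ones
  at every point, not just almost everywhere, which lets closure of eigenspaces under combinations
  apply directly.\<close>

lemma L2_gram_schmidt:
  fixes b :: "nat \<Rightarrow> 'a \<Rightarrow> real"
  assumes "\<And>i. i < k \<Longrightarrow> b i \<in> L2_fun M"
    and "\<And>a. AE x in M. (\<Sum>i<k. a i * b i x) = 0 \<Longrightarrow> \<forall>i<k. a i = 0"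
  shows "\<exists>e. L2_orthonormal M e {..<k} \<and> (\<forall>i<k. \<exists>a. e i = (\<lambda>x. \<Sum>j<k. a j * b j x))"
  using assms
proof (induction k)
  case 0
  then show ?case by (simp add: L2_orthonormal_def)
next
  case (Suc k)
  have bL: "b i \<in> L2_fun M" if "i < Suc k" for i using Suc.prems(1)[OF that] .
  \<comment> \<open>A relation among the first \<open>k\<close> functions is one among
    \<open>Suc k\<close> with last coefficient 0.\<close>
  have ind: "\<forall>i<k. a i = 0" if "AE x in M. (\<Sum>i<k. a i * b i x) = 0" for a
    using Suc.prems(2)[of "a(k := 0)"] that by (force simp: less_Suc_eq)
  obtain e where e: "L2_orthonormal M e {..<k}" and span: "\<forall>i<k. \<exists>a. e i = (\<lambda>x. \<Sum>j<k. a j * b j x)"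
    using Suc.IH[OF bL ind] by auto
  from span obtain A where A: "\<And>i. i < k \<Longrightarrow> e i = (\<lambda>x. \<Sum>j<k. A i j * b j x)" by metis
  define r where "r = (\<lambda>x. b k x - (\<Sum>i<k. L2_inner M (b k) (e i) * e i x))"
  note res = orthonormal_residual[OF e finite_lessThan bL[OF lessI], folded r_def]
  have r_span: "r x = (\<Sum>j<Suc k. (if j = k then 1 else - (\<Sum>i<k. L2_inner M (b k) (e i) * A i j)) * b j x)" for x
  proof -
    have "(\<Sum>i<k. L2_inner M (b k) (e i) * e i x) = (\<Sum>i<k. \<Sum>j<k. L2_inner M (b k) (e i) * (A i j * b j x))"
      using A by (simp add: sum_distrib_left)
    also have "\<dots> = (\<Sum>j<k. (\<Sum>i<k. L2_inner M (b k) (e i) * A i j) * b j x)"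
      by (subst sum.swap) (simp add: sum_distrib_right mult.assoc)
    finally show ?thesis by (simp add: r_def sum_negf)
  qed
  \<comment> \<open>In terms of \<open>b\<close>, the residual has coefficient 1 at index
    \<open>k\<close>, so it cannot vanish almost everywhere.\<close>
  have "L2_inner M r r \<noteq> 0"
  proof
    assume "L2_inner M r r = 0"
    then have "AE x in M. r x = 0" by (rule L2_inner_self_eq_0[OF res(1)])
    from Suc.prems(2)[OF this[unfolded r_span]] show False by auto
  qed
  then have rpos: "L2_inner M r r > 0" using L2_inner_nonneg[of M r] by simp
  define s where "s = 1 / sqrt (L2_inner M r r)"
  define e' where "e' = e(k := (\<lambda>x. s * r x))"
  have ss: "s * s * L2_inner M r r = 1" using rpos by (simp add: s_def)
  have "L2_inner M (\<lambda>x. s * r x) (\<lambda>x. s * r x) = 1"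
    using ss by (simp add: L2_inner_scale_left L2_inner_commute[of M r "\<lambda>x. s * r x"] mult.assoc)
  moreover have "L2_inner M (\<lambda>x. s * r x) (e j) = 0" "L2_inner M (e j) (\<lambda>x. s * r x) = 0" if "j < k" for j
    using res(2)[of j] that by (simp_all add: L2_inner_scale_left L2_inner_commute[of M "e j"])
  moreover have "(\<lambda>x. s * r x) \<in> L2_fun M" using res(1) by (rule L2_fun_scale)
  ultimately have "L2_orthonormal M e' {..<Suc k}"
    using e by (auto simp: L2_orthonormal_def e'_def less_Suc_eq)
  moreover have "\<exists>a. e' i = (\<lambda>x. \<Sum>j<Suc k. a j * b j x)" if "i < Suc k" for i
  proof (cases "i = k")
    case True
    have "e' i = (\<lambda>x. \<Sum>j<Suc k. (s * (if j = k then 1 else - (\<Sum>i<k. L2_inner M (b k) (e i) * A i j))) * b j x)"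
      unfolding True e'_def fun_upd_same r_span sum_distrib_left mult.assoc ..
    then show ?thesis by (intro exI)
  next
    case False
    then have "e' i = (\<lambda>x. \<Sum>j<Suc k. ((A i)(k := 0)) j * b j x)"
      using that A[of i] by (simp add: e'_def)
    then show ?thesis by (intro exI)
  qed
  ultimately show ?case by blast
qed

subsection \<open>Operators with a bounded symmetric kernel\<close>

text \<open>A bounded kernel over a finite measure puts all sections and all images of
  \<open>T\<close> in L2 and makes Fubini applicable; no completeness or spectral theorem
  enters.\<close>

locale symmetric_bounded_kernel = finite_measure M for M :: "'a measure" +
  fixes k :: "'a \<Rightarrow> 'a \<Rightarrow> real" and B :: real
  assumes kernel_measurable: "(\<lambda>(x, y). k x y) \<in> borel_measurable (M \<Otimes>\<^sub>M M)"
    and kernel_bounded: "\<And>x y. x \<in> space M \<Longrightarrow> y \<in> space M \<Longrightarrow> \<bar>k x y\<bar> \<le> B"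
    and kernel_commute: "\<And>x y. k x y = k y x"
begin

definition T :: "('a \<Rightarrow> real) \<Rightarrow> 'a \<Rightarrow> real" where
  "T f x = L2_inner M (k x) f"

lemma bounded_in_L2:
  assumes "f \<in> borel_measurable M" and "\<And>x. x \<in> space M \<Longrightarrow> \<bar>f x\<bar> \<le> C"
  shows "f \<in> L2_fun M"
proof -
  have "integrable M (\<lambda>x. (f x)\<^sup>2)"
    using assms power_mono[OF assms(2) abs_ge_zero, of _ 2]
    by (intro integrable_const_bound[of _ "C\<^sup>2"] AE_I2) auto
  with assms show ?thesis by (simp add: L2_fun_def)
qed

lemma kernel_L2: "x \<in> space M \<Longrightarrow> k x \<in> L2_fun M"
  using kernel_measurable kernel_bounded
  by (intro bounded_in_L2[of _ B]) (auto dest!: measurable_Pair2[where x = x])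

lemma L2_fun_integrable: "f \<in> L2_fun M \<Longrightarrow> integrable M f"
  using L2_fun_mult_integrable[of "\<lambda>_. 1" M f] bounded_in_L2[of "\<lambda>_. 1" 1] by simp

lemma T_L2:
  assumes "f \<in> L2_fun M"
  shows "T f \<in> L2_fun M"
proof (rule bounded_in_L2)
  have [measurable]: "f \<in> borel_measurable M" using assms by (rule L2_fun_measurable)
  have [measurable]: "(\<lambda>(x, y). k x y) \<in> borel_measurable (M \<Otimes>\<^sub>M M)" by (rule kernel_measurable)
  have "(\<lambda>(x, y). k x y * f y) \<in> borel_measurable (M \<Otimes>\<^sub>M M)"
    using borel_measurable_times[OF kernel_measurable, of "\<lambda>p. f (snd p)"] by (simp add: case_prod_beta')
  then show "T f \<in> borel_measurable M"
    unfolding T_def[abs_def] L2_inner_def by (rule borel_measurable_lebesgue_integral)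
  fix x assume x: "x \<in> space M"
  have "\<bar>T f x\<bar> \<le> (\<integral>y. \<bar>k x y * f y\<bar> \<partial>M)"
    unfolding T_def L2_inner_def by (rule integral_abs_bound)
  also have "\<dots> \<le> (\<integral>y. B * \<bar>f y\<bar> \<partial>M)"
    using L2_fun_mult_integrable[OF kernel_L2[OF x] assms] L2_fun_integrable[OF assms] kernel_bounded[OF x]
    by (intro integral_mono integrable_abs integrable_mult_right) (auto simp: abs_mult intro!: mult_right_mono)
  finally show "\<bar>T f x\<bar> \<le> (\<integral>y. B * \<bar>f y\<bar> \<partial>M)" .
qed

text \<open>Fubini applies because the integrand is dominated by a multiple of |f(y)| |g(x)|, and L2
  lies in L1 over a finite measure; exchanging the integrals then swaps the arguments of the
  symmetric kernel.\<close>

lemma T_symmetric: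
  assumes f: "f \<in> L2_fun M" and g: "g \<in> L2_fun M"
  shows "L2_inner M (T f) g = L2_inner M f (T g)"
proof -
  interpret pair_sigma_finite M M ..
  have [measurable]: "f \<in> borel_measurable M" "g \<in> borel_measurable M"
    using assms by (auto intro: L2_fun_measurable)
  have "integrable (M \<Otimes>\<^sub>M M) (\<lambda>(x, y). g x * f y)"
    using L2_fun_integrable[OF f] L2_fun_integrable[OF g]
    by (intro Fubini_integrable) (auto simp: abs_mult)
  then have "integrable (M \<Otimes>\<^sub>M M) (\<lambda>p. B * (case p of (x, y) \<Rightarrow> g x * f y))"
    by (rule integrable_mult_right)
  then have int: "integrable (M \<Otimes>\<^sub>M M) (\<lambda>(x, y). k x y * f y * g x)"
  proof (rule Bochner_Integration.integrable_bound)
    show "(\<lambda>(x, y). k x y * f y * g x) \<in> borel_measurable (M \<Otimes>\<^sub>M M)"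
      using borel_measurable_times[OF kernel_measurable, of "\<lambda>p. f (snd p) * g (fst p)"]
      by (simp add: case_prod_beta' mult.assoc)
    show "AE p in M \<Otimes>\<^sub>M M. norm (case p of (x, y) \<Rightarrow> k x y * f y * g x)
        \<le> norm (B * (case p of (x, y) \<Rightarrow> g x * f y))"
    proof (intro AE_I2, clarsimp simp: space_pair_measure abs_mult)
      fix x y assume "x \<in> space M" "y \<in> space M"
      from kernel_bounded[OF this] have "\<bar>k x y\<bar> \<le> \<bar>B\<bar>" by linarith
      then have "\<bar>k x y\<bar> * (\<bar>f y\<bar> * \<bar>g x\<bar>) \<le> \<bar>B\<bar> * (\<bar>f y\<bar> * \<bar>g x\<bar>)" by (intro mult_right_mono) auto
      then show "\<bar>k x y\<bar> * \<bar>f y\<bar> * \<bar>g x\<bar> \<le> \<bar>B\<bar> * (\<bar>g x\<bar> * \<bar>f y\<bar>)" by (simp add: mult_ac)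
    qed
  qed
  have "L2_inner M (T f) g = (\<integral>x. (\<integral>y. k x y * f y * g x \<partial>M) \<partial>M)"
    by (simp add: L2_inner_def T_def)
  also have "\<dots> = (\<integral>y. (\<integral>x. k x y * f y * g x \<partial>M) \<partial>M)"
    using Fubini_integral[OF int] by simp
  also have "\<dots> = (\<integral>y. (\<integral>x. f y * (k y x * g x) \<partial>M) \<partial>M)"
    by (simp add: kernel_commute mult_ac)
  also have "\<dots> = L2_inner M f (T g)"
    by (simp add: L2_inner_def T_def)
  finally show ?thesis .
qed

text \<open>The value of \<open>T (e i)\<close> at x is the coefficient of the section
  \<open>k x\<close> along \<open>e i\<close>, so Bessel's inequality bounds the sum pointwise by
  \<open>D\<close>, before integration over x.\<close>

lemma orthonormal_image_sum_le:
  assumes e: "L2_orthonormal M e I" and "finite I"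
    and D: "\<And>x. x \<in> space M \<Longrightarrow> L2_inner M (k x) (k x) \<le> D"
  shows "(\<Sum>i\<in>I. L2_inner M (T (e i)) (T (e i))) \<le> D * measure M (space M)"
proof -
  have eL: "\<And>i. i \<in> I \<Longrightarrow> e i \<in> L2_fun M" using e by (auto simp: L2_orthonormal_def)
  have "(\<Sum>i\<in>I. L2_inner M (T (e i)) (T (e i))) = (\<integral>x. (\<Sum>i\<in>I. (T (e i) x)\<^sup>2) \<partial>M)"
    using T_L2[OF eL] by (simp add: L2_inner_def L2_fun_def power2_eq_square)
  also have "\<dots> \<le> (\<integral>x. D \<partial>M)"
  proof (rule integral_mono)
    show "integrable M (\<lambda>x. \<Sum>i\<in>I. (T (e i) x)\<^sup>2)" using T_L2[OF eL] by (auto simp: L2_fun_def)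
    fix x assume x: "x \<in> space M"
    show "(\<Sum>i\<in>I. (T (e i) x)\<^sup>2) \<le> D"
      using L2_bessel_inequality[OF e \<open>finite I\<close> kernel_L2[OF x]] D[OF x] by (simp add: T_def)
  qed simp
  finally show ?thesis by (simp add: mult.commute)
qed

section \<open>Eigenspaces of the operator c T T and the counting bound\<close>

definition eigenspace :: "real \<Rightarrow> real \<Rightarrow> ('a \<Rightarrow> real) set" where
  "eigenspace c \<mu> = {f \<in> L2_fun M. AE x in M. c * T (T f) x = \<mu> * f x}"

text \<open>Symmetry moves one \<open>T\<close> to the other side. Taking \<open>g\<close> =
  \<open>f\<close> expresses the eigenvalue through the norm of \<open>T f\<close>; taking another
  eigenfunction gives orthogonality.\<close>

lemma eigenspace_inner:
  assumes "f \<in> eigenspace c \<mu>" and g: "g \<in> L2_fun M"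
  shows "\<mu> * L2_inner M f g = c * L2_inner M (T f) (T g)"
proof -
  have f: "f \<in> L2_fun M" and AE: "AE x in M. c * T (T f) x = \<mu> * f x"
    using assms by (auto simp: eigenspace_def)
  have "\<mu> * L2_inner M f g = L2_inner M (\<lambda>x. \<mu> * f x) g" by (simp add: L2_inner_scale_left)
  also have "\<dots> = L2_inner M (\<lambda>x. c * T (T f) x) g"
    using AE f g T_L2[OF T_L2[OF f]] by (intro L2_inner_cong_AE L2_fun_measurable[OF L2_fun_scale]) (auto intro: L2_fun_measurable)
  also have "\<dots> = c * L2_inner M (T f) (T g)"
    using T_symmetric[OF T_L2[OF f] g] by (simp add: L2_inner_scale_left)
  finally show ?thesis .
qed

text \<open>The right side of \<open>eigenspace_inner\<close> is symmetric in \<open>f\<close> and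
  \<open>g\<close>, so \<mu> and \<nu> give the same multiple of the inner product.\<close>

lemma eigenspace_orthogonal:
  assumes "f \<in> eigenspace c \<mu>" "g \<in> eigenspace c \<nu>" "\<mu> \<noteq> \<nu>"
  shows "L2_inner M f g = 0"
proof -
  have "\<mu> * L2_inner M f g = \<nu> * L2_inner M g f"
    using eigenspace_inner[OF assms(1), of g] eigenspace_inner[OF assms(2), of f] assms(1,2)
    by (simp add: eigenspace_def L2_inner_commute[of M "T g"])
  then show ?thesis using assms(3) by (simp add: L2_inner_commute[of M g])
qed

lemma T_lincomb:
  assumes "\<And>i. i \<in> I \<Longrightarrow> f i \<in> L2_fun M" "x \<in> space M"
  shows "T (\<lambda>x. \<Sum>i\<in>I. a i * f i x) x = (\<Sum>i\<in>I. a i * T (f i) x)"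
proof -
  have T: "T g x = L2_inner M g (k x)" for g unfolding T_def by (rule L2_inner_commute)
  show ?thesis unfolding T by (rule L2_inner_lincomb_left[OF assms(1) kernel_L2[OF assms(2)]])
qed

lemma eigenspace_lincomb:
  assumes "finite I" "\<And>i. i \<in> I \<Longrightarrow> f i \<in> eigenspace c \<mu>"
  shows "(\<lambda>x. \<Sum>i\<in>I. a i * f i x) \<in> eigenspace c \<mu>"
proof -
  have fL: "\<And>i. i \<in> I \<Longrightarrow> f i \<in> L2_fun M" using assms(2) unfolding eigenspace_def by blast
  have TT: "T (T (\<lambda>x. \<Sum>i\<in>I. a i * f i x)) x = (\<Sum>i\<in>I. a i * T (T (f i)) x)" if x: "x \<in> space M" for x
  proof -
    have "T (T (\<lambda>x. \<Sum>i\<in>I. a i * f i x)) x = T (\<lambda>x. \<Sum>i\<in>I. a i * T (f i) x) x"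
      unfolding T_def[of "T _"] T_def[of "\<lambda>x. \<Sum>i\<in>I. a i * T (f i) x"] L2_inner_def
      by (intro Bochner_Integration.integral_cong refl) (simp add: T_lincomb[OF fL])
    also have "\<dots> = (\<Sum>i\<in>I. a i * T (T (f i)) x)" using fL T_L2 x by (intro T_lincomb) auto
    finally show ?thesis .
  qed
  have "AE x in M. \<forall>i\<in>I. c * T (T (f i)) x = \<mu> * f i x"
    using assms unfolding eigenspace_def by (intro AE_finite_allI) blast+
  then have "AE x in M. c * T (T (\<lambda>x. \<Sum>i\<in>I. a i * f i x)) x = \<mu> * (\<Sum>i\<in>I. a i * f i x)"
  proof (rule AE_mp, intro AE_I2 impI)
    fix x assume x: "x \<in> space M" and eq: "\<forall>i\<in>I. c * T (T (f i)) x = \<mu> * f i x"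
    have "c * T (T (\<lambda>x. \<Sum>i\<in>I. a i * f i x)) x = (\<Sum>i\<in>I. a i * (c * T (T (f i)) x))"
      by (simp add: TT[OF x] sum_distrib_left mult_ac)
    also have "\<dots> = (\<Sum>i\<in>I. a i * (\<mu> * f i x))" using eq by simp
    finally show "c * T (T (\<lambda>x. \<Sum>i\<in>I. a i * f i x)) x = \<mu> * (\<Sum>i\<in>I. a i * f i x)"
      by (simp add: sum_distrib_left mult_ac)
  qed
  then show ?thesis using L2_fun_lincomb[OF fL] by (simp add: eigenspace_def)
qed

text \<open>Uniqueness of the coordinates of the zero function is linear independence of the basis
  modulo null sets, so Gram-Schmidt applies, and combinations stay in the eigenspace.\<close>

lemma eigenspace_orthonormal_basis:
  assumes "has_dim_ae M (eigenspace c \<mu>) d"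
  obtains e where "L2_orthonormal M e {..<d}" and "\<And>i. i < d \<Longrightarrow> e i \<in> eigenspace c \<mu>"
proof -
  obtain b where bV: "\<forall>i<d. b i \<in> eigenspace c \<mu>"
    and uniq: "\<forall>f\<in>eigenspace c \<mu>.
      \<exists>!a. a \<in> extensional {..<d} \<and> (AE x in M. f x = (\<Sum>i<d. a i * b i x))"
    using assms unfolding has_dim_ae_def by (elim exE conjE) (rule that)
  have ex1_eq: "x = y" if "\<exists>!x. P x" "P x" "P y" for P :: "(nat \<Rightarrow> real) \<Rightarrow> bool" and x y
    using that by blast
  have zero: "(\<lambda>x. 0) \<in> eigenspace c \<mu>"
    using eigenspace_lincomb[of "{}"] by simp
  have ind: "\<forall>i<d. a i = 0" if "AE x in M. (\<Sum>i<d. a i * b i x) = 0" for a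
  proof -
    \<comment> \<open>Coordinate vectors are unique only among extensional functions, hence the
      restrictions.\<close>
    have "AE x in M. 0 = (\<Sum>i<d. restrict a {..<d} i * b i x)"
      using that by eventually_elim simp
    moreover have "AE x in M. 0 = (\<Sum>i<d. restrict (\<lambda>_. 0) {..<d} i * b i x)"
      by simp
    ultimately have "restrict a {..<d} = restrict (\<lambda>_. 0) {..<d}"
      by (intro ex1_eq[OF bspec[OF uniq zero]] conjI restrict_extensional)
    then show ?thesis by (metis lessThan_iff restrict_apply')
  qed
  have "b i \<in> L2_fun M" if "i < d" for i using bV that by (simp add: eigenspace_def)
  from L2_gram_schmidt[of d b M, OF this ind] obtain e
    where e: "L2_orthonormal M e {..<d}" and span: "\<forall>i<d. \<exists>a. e i = (\<lambda>x. \<Sum>j<d. a j * b j x)"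
    by blast
  show ?thesis
  proof
    show "L2_orthonormal M e {..<d}" by (rule e)
    fix i assume "i < d"
    then obtain a where "e i = (\<lambda>x. \<Sum>j<d. a j * b j x)" using span by blast
    then show "e i \<in> eigenspace c \<mu>" using eigenspace_lincomb[of "{..<d}" b c \<mu> a] bV by simp
  qed
qed

lemma eigenvalue_count_le:
  fixes lam :: "nat \<Rightarrow> real"
  assumes c: "c \<ge> 0" and D: "\<And>x. x \<in> space M \<Longrightarrow> L2_inner M (k x) (k x) \<le> D"
    and dim: "\<And>\<mu>. finite {n. lam n = \<mu>} \<and> has_dim_ae M (eigenspace c \<mu>) (card {n. lam n = \<mu>})"
    and N: "finite N" "\<And>n. n \<in> N \<Longrightarrow> \<epsilon> < lam n" and "\<epsilon> \<ge> 0"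
  shows "\<epsilon> * card N \<le> c * D * measure M (space M)"
proof -
  let ?d = "\<lambda>\<mu>. card {n. lam n = \<mu>}"
  have "\<exists>e. L2_orthonormal M e {..<?d \<mu>} \<and> (\<forall>i<?d \<mu>. e i \<in> eigenspace c \<mu>)" for \<mu>
    using eigenspace_orthonormal_basis[of c \<mu> "?d \<mu>"] dim[of \<mu>] by metis
  then obtain E where E: "\<And>\<mu>. L2_orthonormal M (E \<mu>) {..<?d \<mu>}"
    and EV: "\<And>\<mu> i. i < ?d \<mu> \<Longrightarrow> E \<mu> i \<in> eigenspace c \<mu>" by metis
  \<comment> \<open>Each distinct value taken on \<open>N\<close> enters once, with a full basis of
    its eigenspace. So \<open>I\<close> has at least as many elements as \<open>N\<close>, while all
    its eigenvalues still exceed \<epsilon>.\<close>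
  define I where "I = (SIGMA \<mu>:lam ` N. {..<?d \<mu>})"
  define e where "e = (\<lambda>(\<mu>, i). E \<mu> i)"
  have finI: "finite I" unfolding I_def using N(1) by blast
  have on: "L2_orthonormal M e I"
    unfolding L2_orthonormal_def
  proof (intro conjI ballI)
    fix p assume "p \<in> I"
    then show "e p \<in> L2_fun M" using EV by (auto simp: I_def e_def eigenspace_def)
  next
    fix p q assume "p \<in> I" "q \<in> I"
    then obtain \<mu> i \<nu> j where p: "p = (\<mu>, i)" "i < ?d \<mu>" and q: "q = (\<nu>, j)" "j < ?d \<nu>"
      by (auto simp: I_def)
    show "L2_inner M (e p) (e q) = (if p = q then 1 else 0)"
    proof (cases "\<mu> = \<nu>")
      case True
      then show ?thesis using E[of \<mu>] p q by (auto simp: L2_orthonormal_def e_def)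
    next
      case False
      then show ?thesis using eigenspace_orthogonal[OF EV[OF p(2)] EV[OF q(2)]] p q by (simp add: e_def)
    qed
  qed
  have ev: "fst p = c * L2_inner M (T (e p)) (T (e p))" if "p \<in> I" for p
  proof -
    have "e p \<in> eigenspace c (fst p)" using that EV by (auto simp: I_def e_def)
    moreover have "e p \<in> L2_fun M" "L2_inner M (e p) (e p) = 1"
      using on that by (auto simp: L2_orthonormal_def)
    ultimately show ?thesis using eigenspace_inner by fastforce
  qed
  have "N \<subseteq> (\<Union>\<mu>\<in>lam ` N. {n. lam n = \<mu>})" by auto
  then have "card N \<le> card (\<Union>\<mu>\<in>lam ` N. {n. lam n = \<mu>})"
    using N(1) dim by (intro card_mono) auto
  also have "\<dots> \<le> (\<Sum>\<mu>\<in>lam ` N. ?d \<mu>)" using N(1) by (intro card_UN_le) auto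
  also have "\<dots> = card I" unfolding I_def using N(1) by (subst card_SigmaI) auto
  finally have "\<epsilon> * card N \<le> (\<Sum>p\<in>I. \<epsilon>)"
    using \<open>\<epsilon> \<ge> 0\<close> by (simp add: mult.commute[of _ \<epsilon>] mult_left_mono)
  also have "\<dots> \<le> (\<Sum>p\<in>I. fst p)"
    using N(2) by (intro sum_mono) (force simp: I_def intro: less_imp_le)
  also have "\<dots> = c * (\<Sum>p\<in>I. L2_inner M (T (e p)) (T (e p)))"
    unfolding sum_distrib_left by (intro sum.cong refl ev)
  also have "\<dots> \<le> c * (D * measure M (space M))"
    by (intro mult_left_mono orthonormal_image_sum_le on finI D c)
  finally show ?thesis by (simp add: mult.assoc)
qed

end

subsection \<open>The finite Hankel transform\<close>

definition hankel_kernel :: "real \<Rightarrow> real \<Rightarrow> real \<Rightarrow> real \<Rightarrow> real" where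
  "hankel_kernel \<alpha> c x y = sqrt (c * x * y) * bessel_J \<alpha> (c * x * y)"

lemma emeasure_unit_measure: "emeasure unit_measure (space unit_measure) = 1"
  by (simp add: unit_measure_def emeasure_restrict_space space_restrict_space)

lemma hankel_kernel_locale:
  assumes "\<alpha> > -1/2" and "c > 0"
  obtains B where "symmetric_bounded_kernel unit_measure (hankel_kernel \<alpha> c) B"
proof -
  obtain B where B: "\<And>t. 0 < t \<Longrightarrow> t \<le> c \<Longrightarrow> \<bar>sqrt t * bessel_J \<alpha> t\<bar> \<le> B"
    using bessel_kernel_bounded[OF assms] by blast
  have "symmetric_bounded_kernel unit_measure (hankel_kernel \<alpha> c) B"
  proof (intro symmetric_bounded_kernel.intro finite_measureI symmetric_bounded_kernel_axioms.intro)
    show "emeasure unit_measure (space unit_measure) \<noteq> \<infinity>" by (simp add: emeasure_unit_measure)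
    have id: "(\<lambda>x. x) \<in> borel_measurable unit_measure" by (rule measurable_unit_measure) simp
    have [measurable]: "fst \<in> borel_measurable (unit_measure \<Otimes>\<^sub>M unit_measure)"
      "snd \<in> borel_measurable (unit_measure \<Otimes>\<^sub>M unit_measure)"
      using measurable_compose[OF measurable_fst id] measurable_compose[OF measurable_snd id] by auto
    show "(\<lambda>(x, y). hankel_kernel \<alpha> c x y) \<in> borel_measurable (unit_measure \<Otimes>\<^sub>M unit_measure)"
      unfolding hankel_kernel_def case_prod_beta' by measurable
    show "hankel_kernel \<alpha> c x y = hankel_kernel \<alpha> c y x" for x y
      by (simp add: hankel_kernel_def mult_ac)
    fix x y assume "x \<in> space unit_measure" "y \<in> space unit_measure"
    then have xy: "0 < x" "x < 1" "0 < y" "y < 1" by (auto simp: space_unit_measure)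
    then have "x * y \<le> 1" by (intro mult_le_one) auto
    then have "c * (x * y) \<le> c" using assms(2) by simp
    then show "\<bar>hankel_kernel \<alpha> c x y\<bar> \<le> B"
      unfolding hankel_kernel_def using xy assms(2) by (intro B) (auto simp: mult.assoc)
  qed
  then show ?thesis by (rule that)
qed

text \<open>The section at x is the case a = c x of the uniform bound, which makes the trace
  estimate 4 c linear in c.\<close>

lemma hankel_kernel_norm_le:
  assumes "\<alpha> > -1/2" and "c > 0" and "x \<in> space unit_measure"
  shows "L2_inner unit_measure (hankel_kernel \<alpha> c x) (hankel_kernel \<alpha> c x) \<le> 4"
proof -
  have "c * x > 0" using assms by (simp add: space_unit_measure)
  then have "(\<integral>\<^sup>+y. ennreal (hankel_kernel \<alpha> c x y * hankel_kernel \<alpha> c x y) \<partial>unit_measure) \<le> ennreal 4"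
    using bessel_kernel_square_nn_integral_le[OF assms(1), of "c * x"]
    by (simp add: hankel_kernel_def power2_eq_square)
  then show ?thesis unfolding L2_inner_def by (intro integral_real_bounded) auto
qed

lemma Q_eigenvalue_count_le:
  assumes "\<alpha> > -1/2" and "c > 0" and lam: "Q_eigenvalue_seq \<alpha> c lam" and "\<epsilon> > 0"
  shows "finite {n. \<epsilon> < lam n} \<and> \<epsilon> * card {n. \<epsilon> < lam n} \<le> 4 * c"
proof -
  obtain B where "symmetric_bounded_kernel unit_measure (hankel_kernel \<alpha> c) B"
    using hankel_kernel_locale[OF assms(1,2)] .
  then interpret symmetric_bounded_kernel unit_measure "hankel_kernel \<alpha> c" B .
  have "hankel_op \<alpha> c f = T f" for f
    by (simp add: fun_eq_iff hankel_op_def T_def L2_inner_def hankel_kernel_def)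
  then have V: "Q_eigenspace \<alpha> c \<mu> = eigenspace c \<mu>" for \<mu>
    by (simp add: Q_eigenspace_def eigenspace_def L2_unit_def L2_fun_def Q_op_def)
  have le: "\<epsilon> * card N \<le> 4 * c" if N: "finite N" "N \<subseteq> {n. \<epsilon> < lam n}" for N
  proof -
    have "\<epsilon> * card N \<le> c * 4 * measure unit_measure (space unit_measure)"
      using lam N assms
      by (intro eigenvalue_count_le[where lam = lam] hankel_kernel_norm_le) (auto simp: Q_eigenvalue_seq_def V)
    then show ?thesis by (simp add: measure_def emeasure_unit_measure)
  qed
  have "finite {n. \<epsilon> < lam n}"
  proof (rule ccontr)
    \<comment> \<open>The bound holds for every finite subset, so one with more than 4 c /
      \<epsilon> elements is contradictory.\<close>
    assume "infinite {n. \<epsilon> < lam n}"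
    then obtain N where N: "finite N" "card N = Suc (nat \<lceil>4 * c / \<epsilon>\<rceil>)" "N \<subseteq> {n. \<epsilon> < lam n}"
      using infinite_arbitrarily_large by blast
    have "4 * c / \<epsilon> < card N" unfolding N(2) by linarith
    then show False using le[OF N(1,3)] assms(4) by (simp add: field_simps)
  qed
  then show ?thesis using le by blast
qed


section \<open>Comparison of the bound 4 c / \<epsilon> with the stated constants\<close>

theorem theorem4:
  fixes \<alpha> c \<epsilon> :: real and lam :: "nat \<Rightarrow> real"
  assumes "\<alpha> > -1/2" and "c \<ge> 1"
    and "Q_eigenvalue_seq \<alpha> c lam"
    and "0 < \<epsilon>" and "\<epsilon> < 1/2"
  shows "finite {n. \<epsilon> < lam n \<and> lam n < 1 - \<epsilon>} \<and>
    real (card {n. \<epsilon> < lam n \<and> lam n < 1 - \<epsilon>}) \<le>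
      (16 * (ln (c / pi) / (2 * pi\<^sup>2) + 3 / (4 * pi ^ 3) + ln (8/3) / pi\<^sup>2 + 2 * c / pi + 1.123)
        + 2 * (C_const \<alpha>)\<^sup>2 + 4 * kappa1 \<alpha> * ln 2 + kappa2 \<alpha> / c\<^sup>2)
      / (\<epsilon> * (1 - \<epsilon>))"
proof -
  let ?S = "{n. \<epsilon> < lam n \<and> lam n < 1 - \<epsilon>}"
  let ?N = "16 * (ln (c / pi) / (2 * pi\<^sup>2) + 3 / (4 * pi ^ 3) + ln (8/3) / pi\<^sup>2 + 2 * c / pi + 1.123)
        + 2 * (C_const \<alpha>)\<^sup>2 + 4 * kappa1 \<alpha> * ln 2 + kappa2 \<alpha> / c\<^sup>2"
  have count: "finite {n. \<epsilon> < lam n}" "\<epsilon> * card {n. \<epsilon> < lam n} \<le> 4 * c"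
    using Q_eigenvalue_count_le[of \<alpha> c lam \<epsilon>] assms by auto
  then have fin: "finite ?S" and card: "card ?S \<le> card {n. \<epsilon> < lam n}"
    by (auto intro: finite_subset card_mono)
  \<comment> \<open>The logarithm is the only term that can be negative; it is at least 1 - \<pi> >
    -3, and with \<pi>^2 \<ge> 9 its contribution is absorbed by the summand 1.123.\<close>
  have "ln (c / pi) \<ge> ln (1 / pi)" using assms(2) by (simp add: divide_right_mono)
  moreover have "ln pi \<le> pi - 1" by (rule ln_le_minus_one) simp
  ultimately have "ln (c / pi) \<ge> -3" using pi_less_4 by (simp add: ln_div)
  moreover have "9 \<le> pi\<^sup>2" using pi_gt3 power_mono[of 3 pi 2] by simp
  then have "3 / (2 * pi\<^sup>2) \<le> 1.123" by (simp add: field_simps)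
  ultimately have "ln (c / pi) / (2 * pi\<^sup>2) \<ge> -1.123"
    using divide_right_mono[of "-3" "ln (c / pi)" "2 * pi\<^sup>2"] by simp
  \<comment> \<open>After multiplication by 16 this term alone gives 8 c, twice what is
    required.\<close>
  moreover have "c / 2 \<le> 2 * c / pi" using pi_less_4 assms(2) by (simp add: field_simps)
  moreover have "3 / (4 * pi ^ 3) \<ge> 0" "ln (8/3) / pi\<^sup>2 \<ge> 0" by simp_all
  ultimately have "8 * c \<le> 16 * (ln (c / pi) / (2 * pi\<^sup>2) + 3 / (4 * pi ^ 3) + ln (8/3) / pi\<^sup>2 + 2 * c / pi + 1.123)"
    by (simp only: distrib_left)
  moreover have "kappa1 \<alpha> \<ge> 0" "kappa2 \<alpha> / c\<^sup>2 \<ge> 0" by (simp_all add: kappa1_def kappa2_def)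
  then have "0 \<le> 2 * (C_const \<alpha>)\<^sup>2 + 4 * kappa1 \<alpha> * ln 2 + kappa2 \<alpha> / c\<^sup>2" by simp
  ultimately have N: "4 * c \<le> ?N" using assms(2) by linarith
  have "\<epsilon> * card ?S \<le> \<epsilon> * card {n. \<epsilon> < lam n}"
    using card assms(4) by (intro mult_left_mono) auto
  with count(2) have "\<epsilon> * card ?S \<le> 4 * c" by (rule order_trans[rotated])
  then have "card ?S \<le> 4 * c / \<epsilon>"
    using assms(4) by (simp only: pos_le_divide_eq mult.commute)
  also have "\<dots> \<le> 4 * c / (\<epsilon> * (1 - \<epsilon>))"
    using assms by (intro divide_left_mono mult_pos_pos) (auto simp: mult_le_cancel_left1)
  also have "\<dots> \<le> ?N / (\<epsilon> * (1 - \<epsilon>))"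
    using N assms(4,5) by (intro divide_right_mono mult_nonneg_nonneg) auto
  finally show ?thesis using fin by blast
qed

end
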